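(* Let $\Gamma$ be a closed piecewise smooth spacelike curve on the de Sitter sphere $\mathbb{S}^2_1$ with index $I\geq 1$ and length $L(\Gamma)$. Then: 1. For all sufficiently large radii $R$, $$\int_{\mathbb{H}^2_R}\bigl(n(Y^\perp)-2I\bigr)\,\mathrm{d}Y=-2L(\Gamma)+4I\pi.$$ 2. As $R\to+\infty$ the integral remains meaningful, i.e. the integral of $n(Y^\perp)-2I$ over all of $\mathbb{H}^2$ is well defined, and $$L(\Gamma)-2I\pi=-\frac12\int_{\mathbb{H}^2}\bigl(n(Y^\perp)-2I\bigr)\,\mathrm{d}Y.$$
   Context: $\mathbb{R}^3_1$ is $\mathbb{R}^3$ with the Lorentz inner product $\langle X,Y\rangle=x_1y_1+x_2y_2-x_3y_3$ in a fixed coordinate system. The de Sitter sphere is $\mathbb{S}^2_1=\{X:\langle X,X\rangle=1\}$, parametrized by latitude and longitude $(\varphi,\theta)$ as $(\cosh\varphi\cos\theta,\cosh\varphi\sin\theta,\sinh\varphi)$. The hyperbolic plane is $\mathbb{H}^2=\{X:\langle X,X\rangle=-1,\ x_3>0\}$ with its induced Riemannian metric of curvature $-1$ and area element $\mathrm{d}Y$; for $R>0$, $\mathbb{H}^2_R=\{X\in\mathbb{H}^2:1\le x_3\le\cosh R\}$ is the closed geodesic disk of radius $R$ about $(0,0,1)$. For $Y\in\mathbb{H}^2$, $Y^\perp$ denotes the closed spacelike geodesic $\{X\in\mathbb{S}^2_1:\langle X,Y\rangle=0\}$ with pole $Y$. The number $n(Y^\perp)$ is the number of intersections of $Y^\perp$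 with $\Gamma$, counted with multiplicity but without sign, i.e. the number of parameter values in one period at which $\Gamma$ lies on $Y^\perp$. A curve on $\mathbb{S}^2_1$ is spacelike if its tangent vectors $v$ satisfy $\langle v,v\rangle>0$ (for piecewise smooth curves: on each of finitely many smooth pieces, including one-sided tangents at the endpoints of the pieces); its length is $L(\Gamma)=\int\sqrt{\langle\Gamma',\Gamma'\rangle}$. On a spacelike curve the longitude $\theta$ has nowhere vanishing derivative; it is assumed that $\theta'>0$ along the whole curve (on every smooth piece). The index $I$ of a closed curve on $\mathbb{S}^2_1$ is its winding number around $\mathbb{S}^2_1$, i.e. the total change of a continuous choice of the longitude $\theta$ along $\Gamma$ over one period equals $2I\pi$. *)

theory Defs
  imports "HOL-Analysis.Analysis"
begin

definition lorentz :: "real^3 \<Rightarrow> real^3 \<Rightarrow> real" where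
  "lorentz X Y = X$1 * Y$1 + X$2 * Y$2 - X$3 * Y$3"

definition de_sitter :: "(real^3) set" where
  "de_sitter = {X. lorentz X X = 1}"

definition de_sitter_point :: "real \<Rightarrow> real \<Rightarrow> real^3" where
  "de_sitter_point \<phi> \<theta> = vector [cosh \<phi> * cos \<theta>, cosh \<phi> * sin \<theta>, sinh \<phi>]"

definition hyp_plane :: "(real^3) set" where
  "hyp_plane = {X. lorentz X X = -1 \<and> X$3 > 0}"

definition hyp_disk :: "real \<Rightarrow> (real^3) set" where
  "hyp_disk R = {X \<in> hyp_plane. 1 \<le> X$3 \<and> X$3 \<le> cosh R}"

text \<open>
  The area element of the hyperbolic plane is the Riemannian one, \<open>sqrt (det g) du\<close>, computed in
  the global chart that writes the plane as a graph over its first two coordinates; \<open>g\<close> is the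
  metric induced by the Lorentz form, i.e. the Gram matrix of the coordinate tangent vectors.
  The resulting measure lives on all Borel sets of the ambient space and is concentrated on
  \<open>hyp_plane\<close>.
\<close>

definition hyp_chart :: "real^2 \<Rightarrow> real^3" where
  "hyp_chart u = vector [u$1, u$2, sqrt (1 + (u$1)\<^sup>2 + (u$2)\<^sup>2)]"

definition hyp_metric :: "real^2 \<Rightarrow> real^2^2" where
  "hyp_metric u = (\<chi> i j. lorentz (frechet_derivative hyp_chart (at u) (axis i 1))
                                (frechet_derivative hyp_chart (at u) (axis j 1)))"

definition hyp_area :: "(real^3) measure" where
  "hyp_area = distr (density lborel (\<lambda>u. ennreal (sqrt (det (hyp_metric u))))) borel hyp_chart"

lemma bij_betw_hyp_chart: "bij_betw hyp_chart UNIV hyp_plane"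
proof (rule bij_betwI[where g = "\<lambda>X. vector [X$1, X$2]"])
  show "hyp_chart \<in> UNIV \<rightarrow> hyp_plane"
    by (auto simp: hyp_chart_def hyp_plane_def lorentz_def power2_eq_square[symmetric]
        add_pos_nonneg intro!: add_pos_nonneg)
next
  fix X :: "real^3" assume X: "X \<in> hyp_plane"
  then have "(X$3)\<^sup>2 = 1 + (X$1)\<^sup>2 + (X$2)\<^sup>2" "X$3 > 0"
    by (auto simp: hyp_plane_def lorentz_def power2_eq_square)
  then have "sqrt (1 + (X$1)\<^sup>2 + (X$2)\<^sup>2) = X$3"
    by (metis real_sqrt_abs abs_of_pos)
  then show "hyp_chart (vector [X$1, X$2]) = X"
    by (simp add: hyp_chart_def vec_eq_iff forall_3)
qed (auto simp: hyp_chart_def vec_eq_iff forall_2)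

definition hyp_perp :: "real^3 \<Rightarrow> (real^3) set" where
  "hyp_perp Y = {X \<in> de_sitter. lorentz X Y = 0}"

text \<open>A closed curve is given on one period \<open>{a..b}\<close>, and \<open>b\<close> represents the same point of the
  closed curve as \<open>a\<close>; so crossings are counted over \<open>{a..<b}\<close>.\<close>

definition crossings :: "(real \<Rightarrow> real^3) \<Rightarrow> real \<Rightarrow> real \<Rightarrow> real^3 \<Rightarrow> real set" where
  "crossings \<Gamma> a b Y = {t \<in> {a..<b}. \<Gamma> t \<in> hyp_perp Y}"

text \<open>The value is 0 when there are infinitely many crossings, so this is the intended number only
  where the set of crossings is finite.\<close>

definition crossing_number :: "(real \<Rightarrow> real^3) \<Rightarrow> real \<Rightarrow> real \<Rightarrow> real^3 \<Rightarrow> nat" where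
  "crossing_number \<Gamma> a b Y = card (crossings \<Gamma> a b Y)"

definition subdivision :: "nat \<Rightarrow> (nat \<Rightarrow> real) \<Rightarrow> real \<Rightarrow> real \<Rightarrow> bool" where
  "subdivision m p a b \<longleftrightarrow> 0 < m \<and> p 0 = a \<and> p m = b \<and> (\<forall>i<m. p i < p (Suc i))"

text \<open>Derivatives of all orders exist on the closed interval, one-sided at its endpoints;
  \<open>D k\<close> is the \<open>k\<close>-th derivative.\<close>

definition smooth_piece :: "real \<Rightarrow> real \<Rightarrow> (real \<Rightarrow> real^3) \<Rightarrow> bool" where
  "smooth_piece c d \<Gamma> \<longleftrightarrow>
     (\<exists>D :: nat \<Rightarrow> real \<Rightarrow> real^3. (\<forall>t\<in>{c..d}. D 0 t = \<Gamma> t) \<and>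
        (\<forall>k. \<forall>t\<in>{c..d}. (D k has_vector_derivative D (Suc k) t) (at t within {c..d})))"

definition closed_piecewise_smooth ::
    "nat \<Rightarrow> (nat \<Rightarrow> real) \<Rightarrow> real \<Rightarrow> real \<Rightarrow> (real \<Rightarrow> real^3) \<Rightarrow> bool" where
  "closed_piecewise_smooth m p a b \<Gamma> \<longleftrightarrow>
     subdivision m p a b \<and> continuous_on {a..b} \<Gamma> \<and> \<Gamma> a = \<Gamma> b \<and>
     (\<forall>i<m. smooth_piece (p i) (p (Suc i)) \<Gamma>)"

definition spacelike_curve :: "nat \<Rightarrow> (nat \<Rightarrow> real) \<Rightarrow> (real \<Rightarrow> real^3) \<Rightarrow> bool" where
  "spacelike_curve m p \<Gamma> \<longleftrightarrow>
     (\<forall>i<m. \<forall>t\<in>{p i..p (Suc i)}.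
        let v = vector_derivative \<Gamma> (at t within {p i..p (Suc i)}) in lorentz v v > 0)"

definition curve_length :: "(real \<Rightarrow> real^3) \<Rightarrow> real \<Rightarrow> real \<Rightarrow> real" where
  "curve_length \<Gamma> a b =
     integral {a..b} (\<lambda>t. sqrt (lorentz (vector_derivative \<Gamma> (at t)) (vector_derivative \<Gamma> (at t))))"

definition longitude_along :: "(real \<Rightarrow> real^3) \<Rightarrow> real \<Rightarrow> real \<Rightarrow> (real \<Rightarrow> real) \<Rightarrow> bool" where
  "longitude_along \<Gamma> a b \<theta> \<longleftrightarrow>
     continuous_on {a..b} \<theta> \<and> (\<forall>t\<in>{a..b}. \<exists>\<phi>. \<Gamma> t = de_sitter_point \<phi> (\<theta> t))"

definition longitude_increasing :: "nat \<Rightarrow> (nat \<Rightarrow> real) \<Rightarrow> (real \<Rightarrow> real) \<Rightarrow> bool" where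
  "longitude_increasing m p \<theta> \<longleftrightarrow>
     (\<forall>i<m. \<forall>t\<in>{p i..p (Suc i)}.
        \<exists>D>0. (\<theta> has_real_derivative D) (at t within {p i..p (Suc i)}))"

text \<open>Continuous longitudes along a curve differ by constants, so the index does not depend on the
  choice of \<open>\<theta>\<close>.\<close>

definition has_index :: "(real \<Rightarrow> real^3) \<Rightarrow> real \<Rightarrow> real \<Rightarrow> int \<Rightarrow> bool" where
  "has_index \<Gamma> a b I \<longleftrightarrow>
     (\<exists>\<theta>. longitude_along \<Gamma> a b \<theta> \<and> \<theta> b - \<theta> a = 2 * of_int I * pi)"

end

theory Submission
  imports Defs
begin

text \<open>Parametrise the pairs of a parameter \<open>t\<close> and a point \<open>Y\<close> of the geodesic of the hyperbolic
  plane orthogonal to \<open>\<Gamma> t\<close> by \<open>t\<close> and the signed distance \<open>s\<close> of \<open>Y\<close> from the point of that geodesic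
  closest to the apex. With \<open>\<phi>\<close> and \<open>\<theta>\<close> the latitude and longitude along \<open>\<Gamma>\<close>, the map to \<open>Y\<close> has
  Jacobian \<open>\<bar>\<phi>' cosh s - \<theta>' cosh \<phi> sinh s\<bar>\<close>, and \<open>Y\<close> lies in the disk of radius \<open>R\<close> iff
  \<open>cosh s cosh \<phi> \<le> cosh R\<close>. So by the area formula the integral of the crossing number over the disk
  is an integral over \<open>t\<close> whose inner integral is elementary: because \<open>\<Gamma>\<close> is spacelike, the Jacobian
  changes sign at one value of \<open>s\<close>, and once that value is inside the disk the result is
  \<open>2 \<theta>' cosh R - 2 \<bar>\<Gamma>'\<bar>\<close>. The total is \<open>4 \<pi> I cosh R - 2 L\<close>. The area \<open>2 \<pi> (cosh R - 1)\<close> of the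
  disk is the special case of the equator, which almost every geodesic meets twice.

  For the whole plane, far from the apex \<open>\<langle>\<Gamma>, Y\<rangle>\<close> changes sign at least \<open>2 I\<close> times by the intermediate
  value theorem. As the integral over the disk does not depend on \<open>R\<close> for large \<open>R\<close>, the
  nonnegative excess \<open>n - 2 I\<close> vanishes almost everywhere there.\<close>

subsection \<open>The area formula\<close>

text \<open>Unlike \<^const>\<open>card\<close>, this is \<open>\<infinity>\<close> on infinite sets.\<close>

abbreviation ecard :: "'a set \<Rightarrow> ennreal" where
  "ecard A \<equiv> emeasure (count_space UNIV) A"

text \<open>\<open>has_measure_differentiable_image\<close> ties finite measure of the image to
  existence of the Jacobian integral, with equal values. The infinite case follows by
  contraposition: a finite Jacobian integral would make the image
  \<open>lmeasurable\<close>.\<close>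

lemma emeasure_differentiable_image_inj:
  fixes f :: "real^'n::{finite,wellorder} \<Rightarrow> real^'n::_"
  assumes S: "S \<in> sets lebesgue"
    and f': "\<And>x. x \<in> S \<Longrightarrow> (f has_derivative f' x) (at x within S)"
    and inj: "inj_on f S"
  shows "emeasure lebesgue (f ` S) = (\<integral>\<^sup>+x. ennreal \<bar>det (matrix (f' x))\<bar> * indicator S x \<partial>lebesgue)"
proof -
  let ?d = "\<lambda>x. \<bar>det (matrix (f' x))\<bar>"
  have im: "f ` S \<in> sets lebesgue"
    using f' by (intro differentiable_image_in_sets_lebesgue)
      (auto simp: S differentiable_on_def differentiable_def)
  have fin: "emeasure lebesgue (f ` S) = (\<integral>\<^sup>+x. ennreal (?d x) * indicator S x \<partial>lebesgue)"
    if "(?d has_integral m) S" for m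
  proof -
    have "f ` S \<in> lmeasurable \<and> measure lebesgue (f ` S) = m"
      using has_measure_differentiable_image[OF S f' inj] that by blast
    then have "emeasure lebesgue (f ` S) = ennreal m"
      by (metis emeasure_eq_measure2)
    with nn_integral_has_integral_lebesgue'[OF _ that] show ?thesis
      by (simp add: nn_integral_completion)
  qed
  show ?thesis
  proof (cases "f ` S \<in> lmeasurable")
    case True
    then show ?thesis
      using fin has_measure_differentiable_image[OF S f' inj] by blast
  next
    case False
    then have top: "emeasure lebesgue (f ` S) = \<infinity>"
      using im by (simp add: fmeasurable_def less_top[symmetric] del: emeasure_completion)
    have meas: "(\<lambda>x. ?d x * indicator S x) \<in> borel_measurable lebesgue"
    proof -
      have "?d \<in> borel_measurable (lebesgue_on S)"
        using borel_measurable_det_Jacobian[OF S f'] by simp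
      then show ?thesis
        using S by (simp add: borel_measurable_restrict_space_iff mult.commute)
    qed
    have "(\<integral>\<^sup>+x. ennreal (?d x) * indicator S x \<partial>lebesgue) = \<infinity>"
    proof (rule ccontr)
      assume "\<not> ?thesis"
      then obtain r where r: "0 \<le> r" "(\<integral>\<^sup>+x. ennreal (?d x) * indicator S x \<partial>lebesgue) = ennreal r"
        by (cases "\<integral>\<^sup>+x. ennreal (?d x) * indicator S x \<partial>lebesgue") auto
      have "((\<lambda>x. ?d x * indicator S x) has_integral r) UNIV"
        unfolding has_integral_iff_nn_integral_lebesgue[of "\<lambda>x. ?d x * indicator S x", simplified]
        using meas r by (auto simp: ennreal_mult' ennreal_indicator)
      then have "(?d has_integral r) S"
        by (subst has_integral_restrict_UNIV[symmetric], elim has_integral_eq[rotated]) auto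
      then have "f ` S \<in> lmeasurable"
        using has_measure_differentiable_image[OF S f' inj] by blast
      with False show False ..
    qed
    with top show ?thesis by simp
  qed
qed

text \<open>Both sides integrate \<open>w\<close> against a Borel measure: Lebesgue measure
  restricted to the image, and the push-forward of the Jacobian density. These agree on a Borel set
  \<open>E\<close> by the previous lemma, applied to the part of \<open>S\<close> that
  \<open>f\<close> maps into \<open>E\<close>.\<close>

lemma nn_integral_differentiable_image_inj:
  fixes f :: "real^'n::{finite,wellorder} \<Rightarrow> real^'n::_" and w :: "real^'n::_ \<Rightarrow> ennreal"
  assumes S: "S \<in> sets lebesgue"
    and f': "\<And>x. x \<in> S \<Longrightarrow> (f has_derivative f' x) (at x within S)"
    and inj: "inj_on f S"
    and w[measurable]: "w \<in> borel_measurable borel"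
  shows "(\<integral>\<^sup>+y. w y * indicator (f ` S) y \<partial>lebesgue) =
    (\<integral>\<^sup>+x. w (f x) * ennreal \<bar>det (matrix (f' x))\<bar> * indicator S x \<partial>lebesgue)"
proof -
  let ?d = "\<lambda>x. ennreal \<bar>det (matrix (f' x))\<bar> * indicator S x"
  \<comment> \<open>Extension by 0 makes the map measurable on the whole space; on \<open>S\<close>,
    where the Jacobian density lives, it is \<open>f\<close>.\<close>
  define g where "g x = (if x \<in> S then f x else 0)" for x
  have cont: "continuous_on S f"
    using f' has_derivative_continuous_on by blast
  have g[measurable]: "g \<in> borel_measurable lebesgue"
  proof -
    have "f \<in> borel_measurable (lebesgue_on S)"
      using S cont by (simp add: continuous_imp_measurable_on_sets_lebesgue)
    then show ?thesis
      unfolding g_def using S borel_measurable_if by blast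
  qed
  have d[measurable]: "?d \<in> borel_measurable lebesgue"
  proof -
    have "(\<lambda>x. ennreal \<bar>det (matrix (f' x))\<bar>) \<in> borel_measurable (lebesgue_on S)"
      using borel_measurable_det_Jacobian[OF S f'] by simp
    then show ?thesis
      using S by (subst (asm) borel_measurable_restrict_space_iff_ennreal) (auto simp: mult.commute)
  qed
  have im: "f ` S \<in> sets lebesgue"
    using f' by (intro differentiable_image_in_sets_lebesgue)
      (auto simp: S differentiable_on_def differentiable_def)
  have bl: "(\<lambda>x. x) \<in> measurable lebesgue borel"
    by (simp add: measurable_completion)
  let ?A = "distr (density lebesgue (indicator (f ` S))) borel (\<lambda>x. x)"
  let ?B = "distr (density lebesgue ?d) borel g"
  have "?A = ?B"
  proof (rule measure_eqI)
    fix E assume "E \<in> sets ?A"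
    then have E[measurable]: "E \<in> sets borel" by simp
    have El: "E \<in> sets lebesgue" using E by auto
    have gE: "g -` E \<in> sets lebesgue"
      using measurable_sets[OF g E] by simp
    have SE: "S \<inter> g -` E \<in> sets lebesgue" using S gE by auto
    have "emeasure ?A E = (\<integral>\<^sup>+y. indicator (f ` S) y * indicator E y \<partial>lebesgue)"
      using bl im E El
      by (subst emeasure_distr) (auto simp: emeasure_density simp del: nn_integral_indicator)
    also have "\<dots> = (\<integral>\<^sup>+y. indicator (f ` S \<inter> E) y \<partial>lebesgue)"
      by (intro nn_integral_cong) (auto simp: indicator_def)
    also have "\<dots> = emeasure lebesgue (f ` S \<inter> E)"
      using im El by (intro nn_integral_indicator) auto
    also have "f ` S \<inter> E = f ` (S \<inter> g -` E)"
      by (auto simp: g_def)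
    also have "emeasure lebesgue \<dots> =
        (\<integral>\<^sup>+x. ennreal \<bar>det (matrix (f' x))\<bar> * indicator (S \<inter> g -` E) x \<partial>lebesgue)"
      using SE inj f' by (intro emeasure_differentiable_image_inj)
        (auto intro: inj_on_subset has_derivative_subset)
    also have "\<dots> = (\<integral>\<^sup>+x. ?d x * indicator (g -` E) x \<partial>lebesgue)"
      by (intro nn_integral_cong) (auto simp: indicator_def)
    also have "\<dots> = emeasure ?B E"
      using gE by (simp add: emeasure_distr emeasure_density)
    finally show "emeasure ?A E = emeasure ?B E" .
  qed simp
  then have "(\<integral>\<^sup>+y. w y \<partial>?A) = (\<integral>\<^sup>+y. w y \<partial>?B)" by simp
  moreover have "(\<integral>\<^sup>+y. w y \<partial>?A) = (\<integral>\<^sup>+y. indicator (f ` S) y * w y \<partial>lebesgue)"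
    using bl im by (simp add: nn_integral_distr nn_integral_density measurable_completion)
  moreover have "(\<integral>\<^sup>+y. w y \<partial>?B) = (\<integral>\<^sup>+x. ?d x * w (g x) \<partial>lebesgue)"
    by (simp add: nn_integral_distr nn_integral_density)
  moreover have "(\<integral>\<^sup>+x. ?d x * w (g x) \<partial>lebesgue) =
      (\<integral>\<^sup>+x. w (f x) * ennreal \<bar>det (matrix (f' x))\<bar> * indicator S x \<partial>lebesgue)"
    by (intro nn_integral_cong) (auto simp: indicator_def g_def mult.commute)
  ultimately show ?thesis by (simp add: mult.commute)
qed

text \<open>The injectivity half of the inverse function theorem.
  \<open>has_derivative_locally_injective\<close> asks for continuity of the derivative in operator
  norm, which comes here from continuity of the matrix \<open>J\<close>.\<close>

lemma C1_locally_injective: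
  fixes f :: "real^'n \<Rightarrow> real^'n" and J :: "real^'n \<Rightarrow> real^'n^'n"
  assumes S: "open S" "a \<in> S"
    and f': "\<And>x. x \<in> S \<Longrightarrow> (f has_derivative (\<lambda>h. J x *v h)) (at x)"
    and J: "continuous_on S J" and det: "det (J a) \<noteq> 0"
  obtains r where "r > 0" "ball a r \<subseteq> S" "inj_on f (ball a r)"
proof -
  obtain K where K: "K ** J a = mat 1"
    using det invertible_det_nz invertible_def by blast
  show thesis
  proof (rule has_derivative_locally_injective[OF S(2,1), of "(*v) K" "\<lambda>x. (*v) (J x)"])
    show "bounded_linear ((*v) K)"
      by (simp add: matrix_vector_mul_bounded_linear)
    show "(*v) K \<circ> (*v) (J a) = id"
      using K by (auto simp: fun_eq_iff matrix_vector_mul_assoc)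
    fix e :: real assume e: "e > 0"
    \<comment> \<open>\<open>N\<close> is the number of matrix entries: the operator norm is at most
      \<open>N\<close> times a bound on the entries, so \<open>e / (2 * N)\<close> per entry stays
      strictly below \<open>e\<close>.\<close>
    define N where "N = real CARD('n) * real CARD('n)"
    have N: "N > 0" by (simp add: N_def)
    have "isCont J a" using J S continuous_on_eq_continuous_at by blast
    then obtain d where d: "d > 0" "\<And>x. dist x a < d \<Longrightarrow> dist (J x) (J a) < e / (2 * N)"
      using e N unfolding continuous_at_eps_delta by (metis divide_pos_pos mult_pos_pos zero_less_numeral)
    have "onorm (\<lambda>v. J x *v v - J a *v v) < e" if "dist a x < d" for x
    proof -
      have *: "\<bar>(J x - J a) $ i $ j\<bar> \<le> e / (2 * N)" for i j
      proof -
        have "\<bar>(J x - J a) $ i $ j\<bar> \<le> norm ((J x - J a) $ i)" by (rule component_le_norm_cart)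
        also have "\<dots> \<le> norm (J x - J a)" by (rule Finite_Cartesian_Product.norm_nth_le)
        also have "\<dots> \<le> e / (2 * N)" using d(2)[of x] that by (simp add: dist_norm dist_commute norm_minus_commute)
        finally show ?thesis .
      qed
      have "onorm ((*v) (J x - J a)) \<le> real CARD('n) * real CARD('n) * (e / (2 * N))"
        using * by (rule onorm_le_matrix_component)
      also have "\<dots> < e" using e N unfolding N_def[symmetric] by (simp add: field_simps)
      finally have "onorm (\<lambda>v. (J x - J a) *v v) < e" .
      then show ?thesis by (simp only: matrix_vector_mult_diff_rdistrib)
    qed
    then show "\<exists>d>0. \<forall>x. dist a x < d \<longrightarrow> onorm (\<lambda>v. J x *v v - J a *v v) < e"
      using d(1) by blast
  qed (use f' that in auto)
qed

text \<open>Away from the critical points the domain splits into countably many Borel pieces on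
  which \<open>f\<close> is injective. There the change of variables applies, and the number of
  preimages is the sum of the indicators of the images. The critical points have a null image by
  Sard's theorem and add nothing on the right, as the determinant vanishes.\<close>

theorem nn_integral_area_formula:
  fixes f :: "real^'n::{finite,wellorder} \<Rightarrow> real^'n::_" and J :: "real^'n::_ \<Rightarrow> real^'n::_^'n::_"
    and w :: "real^'n::_ \<Rightarrow> ennreal"
  assumes S: "open S"
    and f': "\<And>x. x \<in> S \<Longrightarrow> (f has_derivative (\<lambda>h. J x *v h)) (at x)"
    and J: "continuous_on S J"
    and w[measurable]: "w \<in> borel_measurable borel"
  shows "(\<integral>\<^sup>+y. w y * ecard {x \<in> S. f x = y} \<partial>lborel) =
    (\<integral>\<^sup>+x. w (f x) * ennreal \<bar>det (J x)\<bar> * indicator S x \<partial>lborel)"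
proof -
  define P where "P = {x \<in> S. det (J x) \<noteq> 0}"
  have contdet: "continuous_on S (\<lambda>x. det (J x))"
    unfolding det_def by (intro continuous_intros J)
  have "open P"
  proof -
    have "P = S \<inter> (\<lambda>x. det (J x)) -` (- {0})" by (auto simp: P_def)
    with S contdet show ?thesis
      by (metis continuous_open_preimage open_Compl closed_singleton)
  qed
  define \<F> where "\<F> = {B. open B \<and> B \<subseteq> P \<and> inj_on f B}"
  have UF: "\<Union>\<F> = P"
  proof
    show "P \<subseteq> \<Union>\<F>"
    proof
      fix a assume "a \<in> P"
      then obtain r where "r > 0" "ball a r \<subseteq> P" "inj_on f (ball a r)"
        using C1_locally_injective[of P a f J] f' J \<open>open P\<close>
        by (auto simp: P_def intro: continuous_on_subset)
      then show "a \<in> \<Union>\<F>" by (auto simp: \<F>_def intro!: exI[of _ "ball a r"])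
    qed
  qed (auto simp: \<F>_def)
  obtain \<F>' where F': "\<F>' \<subseteq> \<F>" "countable \<F>'" "\<Union>\<F>' = P"
    using Lindelof[of \<F>] UF by (auto simp: \<F>_def)
  \<comment> \<open>Adding the empty set keeps the enumerated family nonempty, so that the
    enumeration has exactly this family as its range.\<close>
  define B where "B = from_nat_into (insert {} \<F>')"
  have rB: "range B = insert {} \<F>'"
    unfolding B_def using F'(2) by (intro range_from_nat_into) auto
  have B: "open (B n)" "B n \<subseteq> P" "inj_on f (B n)" for n
    using rB F'(1) by (auto simp: \<F>_def dest!: equalityD1 range_subsetD[of _ _ n])
  have UB: "(\<Union>n. B n) = P" using rB F'(3) by auto
  define D where "D = disjointed B"
  have DB: "D n \<subseteq> B n" for n unfolding D_def by (rule disjointed_subset)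
  have UD: "(\<Union>n. D n) = P" unfolding D_def UN_disjointed_eq UB ..
  have dD: "disjoint_family D" unfolding D_def by (rule disjoint_family_disjointed)
  have D[measurable]: "D n \<in> sets borel" for n
  proof -
    have "range D \<subseteq> sets borel" unfolding D_def using B(1)
      by (intro sets.range_disjointed_sets) auto
    then show ?thesis by auto
  qed
  have Dl: "D n \<in> sets lebesgue" for n using D by auto
  have DS: "D n \<subseteq> S" for n using DB B(2) by (auto simp: P_def)
  have injD: "inj_on f (D n)" for n using DB B(3) inj_on_subset by blast
  have der: "(f has_derivative (*v) (J x)) (at x within D n)" if "x \<in> D n" for x n
    using f'[of x] DS that by (auto intro: has_derivative_at_withinI)
  have im: "f ` D n \<in> sets lebesgue" for n
    using der by (intro differentiable_image_in_sets_lebesgue)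
      (auto simp: Dl differentiable_on_def differentiable_def)

  have card_D: "ecard {x \<in> D n. f x = y} = indicator (f ` D n) y" for n y
  proof (cases "y \<in> f ` D n")
    case True
    then obtain x where "x \<in> D n" "f x = y" by auto
    then have "{x \<in> D n. f x = y} = {x}" using injD[of n] by (auto simp: inj_on_def)
    then show ?thesis using True by simp
  next
    case False
    then have "{x \<in> D n. f x = y} = {}" by auto
    then have "ecard {x \<in> D n. f x = y} = 0" by (simp only: emeasure_empty)
    then show ?thesis using False by simp
  qed
  have card_P: "ecard {x \<in> P. f x = y} = (\<Sum>n. indicator (f ` D n) y)" for y
  proof -
    have "{x \<in> P. f x = y} = (\<Union>n. {x \<in> D n. f x = y})" using UD by auto
    then have "ecard {x \<in> P. f x = y} = ecard (\<Union>n. {x \<in> D n. f x = y})" by simp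
    also have "\<dots> = (\<Sum>n. ecard {x \<in> D n. f x = y})"
      using dD by (intro suminf_emeasure[symmetric]) (auto simp: disjoint_family_on_def)
    finally show ?thesis by (simp add: card_D)
  qed
  have "negligible (f ` (S - P))"
  proof (rule baby_Sard)
    fix x assume x: "x \<in> S - P"
    then show "(f has_derivative (*v) (J x)) (at x within S - P)"
      using f'[of x] by (auto intro: has_derivative_at_withinI)
    show "rank (matrix ((*v) (J x))) < CARD('n)"
      using x by (simp add: P_def det_eq_0_rank)
  qed simp
  then have "AE y in lebesgue. y \<notin> f ` (S - P)"
    by (simp add: negligible_iff_null_sets AE_not_in)
  then have AE_P: "AE y in lebesgue. ecard {x \<in> S. f x = y} = ecard {x \<in> P. f x = y}"
  proof eventually_elim
    case (elim y)
    then have "{x \<in> S. f x = y} = {x \<in> P. f x = y}" by (auto simp: P_def)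
    then show ?case by simp
  qed

  \<comment> \<open>Extended by 0, the map and its determinant are Borel on the whole space, so the
    sum and the integral may be interchanged.\<close>
  define g where "g x = (if x \<in> S then f x else 0)" for x
  have "continuous_on S f"
    using f' by (intro has_derivative_continuous_on[of S f "\<lambda>x. (*v) (J x)"])
      (auto intro: has_derivative_at_withinI)
  then have g[measurable]: "g \<in> borel_measurable borel"
    unfolding g_def using S by (intro borel_measurable_continuous_on_if) auto
  define d where "d x = (if x \<in> S then det (J x) else 0)" for x
  have d[measurable]: "d \<in> borel_measurable borel"
    unfolding d_def using S contdet by (intro borel_measurable_continuous_on_if) auto

  have "(\<integral>\<^sup>+y. w y * ecard {x \<in> S. f x = y} \<partial>lborel) =
      (\<integral>\<^sup>+y. w y * ecard {x \<in> S. f x = y} \<partial>lebesgue)"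
    by (simp add: nn_integral_completion)
  also have "\<dots> = (\<integral>\<^sup>+y. (\<Sum>n. w y * indicator (f ` D n) y) \<partial>lebesgue)"
    using AE_P by (intro nn_integral_cong_AE) (auto simp: card_P)
  also have "\<dots> = (\<Sum>n. \<integral>\<^sup>+y. w y * indicator (f ` D n) y \<partial>lebesgue)"
    using im w by (intro nn_integral_suminf borel_measurable_times_ennreal borel_measurable_indicator)
      (auto simp: measurable_completion)
  also have "\<dots> = (\<Sum>n. \<integral>\<^sup>+x. w (f x) * ennreal \<bar>det (matrix ((*v) (J x)))\<bar> * indicator (D n) x \<partial>lebesgue)"
    by (intro suminf_cong nn_integral_differentiable_image_inj Dl der injD w)
  also have "\<dots> = (\<Sum>n. \<integral>\<^sup>+x. w (g x) * ennreal \<bar>d x\<bar> * indicator (D n) x \<partial>lborel)"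
    unfolding nn_integral_completion using DS
    by (intro suminf_cong nn_integral_cong) (auto simp: indicator_def g_def d_def)
  also have "\<dots> = (\<integral>\<^sup>+x. (\<Sum>n. w (g x) * ennreal \<bar>d x\<bar> * indicator (D n) x) \<partial>lborel)"
    by (intro nn_integral_suminf[symmetric]) auto
  also have "\<dots> = (\<integral>\<^sup>+x. w (f x) * ennreal \<bar>det (J x)\<bar> * indicator S x \<partial>lborel)"
  proof (intro nn_integral_cong)
    fix x
    have "(\<Sum>n. w (g x) * ennreal \<bar>d x\<bar> * indicator (D n) x) = w (g x) * ennreal \<bar>d x\<bar> * indicator P x"
      using suminf_indicator[OF dD, of x] UD by simp
    also have "\<dots> = w (f x) * ennreal \<bar>det (J x)\<bar> * indicator S x"
      by (auto simp: indicator_def P_def g_def d_def)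
    finally show "(\<Sum>n. w (g x) * ennreal \<bar>d x\<bar> * indicator (D n) x) =
      w (f x) * ennreal \<bar>det (J x)\<bar> * indicator S x" .
  qed
  finally show ?thesis .
qed

subsection \<open>Counting zeros and computing integrals\<close>

text \<open>The floor map merges points in the same cell of width \<open>1 / n\<close>, so it never
  increases the count, and it separates any given finite set once the cells are finer than the gaps.
  This reduces counting to countably many questions whether a cell is occupied.\<close>

lemma ecard_eq_SUP_floor:
  fixes A :: "real set"
  shows "ecard A = (SUP n. ecard ((\<lambda>t. \<lfloor>real n * t\<rfloor>) ` A))"
proof (rule antisym)
  have *: "of_nat (card F) \<le> (SUP n. ecard ((\<lambda>t. \<lfloor>real n * t\<rfloor>) ` A))" if F: "finite F" "F \<subseteq> A" for F
  proof -
    have "\<forall>\<^sub>F n in sequentially. \<forall>s\<in>F. \<forall>t\<in>F. s \<noteq> t \<longrightarrow> \<lfloor>real n * s\<rfloor> \<noteq> \<lfloor>real n * t\<rfloor>"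
    proof (intro eventually_ball_finite ballI F)
      fix s t
      show "\<forall>\<^sub>F n in sequentially. s \<noteq> t \<longrightarrow> \<lfloor>real n * s\<rfloor> \<noteq> \<lfloor>real n * t\<rfloor>"
      proof (cases "s = t")
        case False
        then have "\<forall>\<^sub>F n in sequentially. real n > 1 / \<bar>s - t\<bar>"
          using filterlim_real_sequentially filterlim_at_top_dense by blast
        then show ?thesis
        proof eventually_elim
          case (elim n)
          then have "real n * \<bar>s - t\<bar> > 1"
            using False by (simp add: field_simps)
          moreover have "\<bar>real n * s - real n * t\<bar> = real n * \<bar>s - t\<bar>"
            by (simp add: abs_mult flip: right_diff_distrib)
          ultimately show ?case by linarith
        qed
      qed simp
    qed
    then obtain n where "inj_on (\<lambda>t. \<lfloor>real n * t\<rfloor>) F"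
      unfolding eventually_sequentially inj_on_def by (metis order_refl)
    then have "of_nat (card F) = ecard ((\<lambda>t. \<lfloor>real n * t\<rfloor>) ` F)"
      using F by (simp add: card_image emeasure_count_space)
    also have "\<dots> \<le> ecard ((\<lambda>t. \<lfloor>real n * t\<rfloor>) ` A)"
      using F by (intro emeasure_mono) auto
    also have "\<dots> \<le> (SUP n. ecard ((\<lambda>t. \<lfloor>real n * t\<rfloor>) ` A))"
      by (rule SUP_upper) simp
    finally show ?thesis .
  qed
  show "ecard A \<le> (SUP n. ecard ((\<lambda>t. \<lfloor>real n * t\<rfloor>) ` A))" (is "_ \<le> ?S")
  proof (cases "finite A")
    case True
    with *[of A] show ?thesis by (simp add: emeasure_count_space)
  next
    case False
    have "?S = top"
    proof (rule ccontr)
      assume "?S \<noteq> top"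
      then obtain k :: nat where k: "?S < of_nat k"
        using ennreal_Ex_less_of_nat less_top by blast
      obtain F where "F \<subseteq> A" "finite F" "card F = k"
        using False infinite_arbitrarily_large by blast
      with *[of F] k show False by (meson leD)
    qed
    then show ?thesis by (simp only: top_greatest)
  qed
  show "?S \<le> ecard A"
  proof (rule SUP_least)
    fix n :: nat
    show "ecard ((\<lambda>t. \<lfloor>real n * t\<rfloor>) ` A) \<le> ecard A"
      by (cases "finite A") (simp_all add: emeasure_count_space card_image_le)
  qed
qed

text \<open>The zero count is the supremum over \<open>n\<close> of the number of cells of width
  \<open>1 / n\<close> that contain a zero. For one cell, the set of \<open>y\<close> with a zero in
  it is a countable union of closed sets, hence Borel.\<close>

lemma borel_measurable_ecard_zeros:
  fixes h :: "real \<Rightarrow> 'b::euclidean_space \<Rightarrow> real"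
  assumes h: "continuous_on ({a..b} \<times> UNIV) (\<lambda>(t, y). h t y)"
  shows "(\<lambda>y. ecard {t \<in> {a..<b}. h t y = 0}) \<in> borel_measurable borel"
proof -
  define E where "E n k = {y. \<exists>t\<in>{a..<b}. \<lfloor>real n * t\<rfloor> = k \<and> h t y = 0}" for n :: nat and k
  have E[measurable]: "E n k \<in> sets borel" for n k
  proof -
    \<comment> \<open>Both the cell and \<open>{a..<b}\<close> are open on the right. The compact
      sets \<open>C i\<close> stay \<open>1 / (i + 1)\<close> away from these ends and exhaust the
      intersection; compactness makes the projection of the closed zero set closed.\<close>
    define C where "C i = {t \<in> {a..b}. t \<le> b - 1 / real (Suc i) \<and>
        of_int k \<le> real n * t \<and> real n * t \<le> of_int k + 1 - 1 / real (Suc i)}" for i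
    have C: "compact (C i)" for i
    proof -
      have "C i = {a..b} \<inter> ({..b - 1 / real (Suc i)} \<inter>
          (\<lambda>t. real n * t) -` {of_int k..of_int k + 1 - 1 / real (Suc i)})"
        by (auto simp: C_def)
      also have "compact \<dots>"
        by (intro compact_Int_closed closed_Int closed_vimage) (auto intro!: continuous_intros)
      finally show ?thesis .
    qed
    have "E n k = (\<Union>i. {y. \<exists>t\<in>C i. h t y = 0})"
    proof (intro equalityI subsetI)
      fix y assume "y \<in> E n k"
      then obtain t where t: "t \<in> {a..<b}" "\<lfloor>real n * t\<rfloor> = k" "h t y = 0"
        by (auto simp: E_def)
      then have "min (b - t) (of_int k + 1 - real n * t) > 0" by auto
      then obtain i where "inverse (real (Suc i)) < min (b - t) (of_int k + 1 - real n * t)"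
        using reals_Archimedean by blast
      then have "t \<in> C i" using t by (auto simp: C_def inverse_eq_divide)
      with t(3) show "y \<in> (\<Union>i. {y. \<exists>t\<in>C i. h t y = 0})" by auto
    next
      fix y assume "y \<in> (\<Union>i. {y. \<exists>t\<in>C i. h t y = 0})"
      then obtain i t where t: "t \<in> C i" "h t y = 0" by auto
      have "1 / real (Suc i) > 0" by simp
      with t(1) have "t \<in> {a..<b}" "of_int k \<le> real n * t" "real n * t < of_int k + 1"
        unfolding C_def atLeastAtMost_iff atLeastLessThan_iff mem_Collect_eq by argo+
      then have "\<lfloor>real n * t\<rfloor> = k" by linarith
      with t \<open>t \<in> {a..<b}\<close> show "y \<in> E n k" by (auto simp: E_def)
    qed
    moreover have "closed {y. \<exists>t\<in>C i. h t y = 0}" for i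
    proof -
      have "C i \<times> UNIV \<subseteq> {a..b} \<times> (UNIV :: 'b set)" by (auto simp: C_def)
      then have "closed ((C i \<times> UNIV) \<inter> (\<lambda>(t, y). h t y) -` {0})"
        using C h by (intro continuous_closed_preimage closed_Times)
          (auto intro: continuous_on_subset compact_imp_closed)
      from closed_compact_projection[OF C this]
      have "closed {y. \<exists>t. t \<in> C i \<and> (t, y) \<in> (C i \<times> UNIV) \<inter> (\<lambda>(t, y). h t y) -` {0}}" .
      also have "{y. \<exists>t. t \<in> C i \<and> (t, y) \<in> (C i \<times> UNIV) \<inter> (\<lambda>(t, y). h t y) -` {0}} =
          {y. \<exists>t\<in>C i. h t y = 0}" by auto
      finally show ?thesis .
    qed
    ultimately show ?thesis by auto
  qed
  have "ecard {t \<in> {a..<b}. h t y = 0} =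
      (SUP n. \<Sum>k\<in>{\<lfloor>real n * a\<rfloor>..\<lfloor>real n * b\<rfloor>}. indicator (E n k) y)" for y
  proof -
    have "ecard ((\<lambda>t. \<lfloor>real n * t\<rfloor>) ` {t \<in> {a..<b}. h t y = 0}) =
      (\<Sum>k\<in>{\<lfloor>real n * a\<rfloor>..\<lfloor>real n * b\<rfloor>}. indicator (E n k) y)" for n
    proof -
      let ?K = "{\<lfloor>real n * a\<rfloor>..\<lfloor>real n * b\<rfloor>}"
      have "(\<lambda>t. \<lfloor>real n * t\<rfloor>) ` {t \<in> {a..<b}. h t y = 0} = {k \<in> ?K. y \<in> E n k}"
        by (auto simp: E_def intro!: floor_mono mult_left_mono)
      moreover have "finite {k \<in> ?K. y \<in> E n k}" by (rule finite_subset[of _ ?K]) auto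
      ultimately have "ecard ((\<lambda>t. \<lfloor>real n * t\<rfloor>) ` {t \<in> {a..<b}. h t y = 0}) = of_nat (card {k \<in> ?K. y \<in> E n k})"
        by (simp only: emeasure_count_space_finite[OF subset_UNIV])
      also have "\<dots> = (\<Sum>k\<in>?K. indicator (E n k) y)"
        by (simp add: indicator_def sum.If_cases Int_def of_bool_def)
      finally show ?thesis .
    qed
    then show ?thesis by (subst ecard_eq_SUP_floor) simp
  qed
  then show ?thesis by simp
qed

section \<open>An elementary integral, and iterated integration in the plane\<close>

text \<open>With \<open>l = sqrt (A\<^sup>2 - B\<^sup>2)\<close> there is \<open>s0\<close> such
  that \<open>A = l * cosh s0\<close> and \<open>B = l * sinh s0\<close>. The integrand becomes
  \<open>l * \<bar>sinh (s0 - s)\<bar>\<close>, with its only sign change at \<open>s0\<close>. The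
  assumption on \<open>C\<close> says \<open>cosh s0 \<le> C\<close>, so \<open>s0\<close> belongs
  to the interval of integration.\<close>

lemma nn_integral_abs_cosh_sinh:
  fixes A B C :: real
  assumes AB: "\<bar>B\<bar> < A" and C: "A / sqrt (A\<^sup>2 - B\<^sup>2) \<le> C"
  shows "(\<integral>\<^sup>+s. ennreal \<bar>B * cosh s - A * sinh s\<bar> * indicator {s. cosh s \<le> C} s \<partial>lborel) =
    ennreal (2 * A * C - 2 * sqrt (A\<^sup>2 - B\<^sup>2))"
proof -
  define l where "l = sqrt (A\<^sup>2 - B\<^sup>2)"
  have "B\<^sup>2 < A\<^sup>2" using AB power_strict_mono[of "\<bar>B\<bar>" A 2] by simp
  then have l: "l > 0" "l\<^sup>2 = A\<^sup>2 - B\<^sup>2" by (simp_all add: l_def)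
  define s0 where "s0 = arsinh (B / l)"
  have sinh0: "l * sinh s0 = B" using l by (simp add: s0_def)
  have cosh0: "l * cosh s0 = A"
  proof -
    have "(l * cosh s0)\<^sup>2 = A\<^sup>2"
      using l by (simp add: power_mult_distrib cosh_square_eq distrib_left flip: sinh0)
    then show ?thesis using l AB by (simp add: power2_eq_iff_nonneg)
  qed
  have "A / l = cosh s0" using cosh0 l by (simp add: divide_eq_eq mult.commute)
  then have C0: "cosh s0 \<le> C" using C by (simp only: l_def[symmetric])
  then have C1: "C \<ge> 1" using cosh_real_ge_1[of s0] by linarith
  define S where "S = arcosh C"
  have S: "S \<ge> 0" "cosh S = C" using C1 by (auto simp: S_def)
  have iff: "cosh s \<le> C \<longleftrightarrow> s \<in> {-S..S}" for s
  proof -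
    have "cosh s \<le> C \<longleftrightarrow> cosh \<bar>s\<bar> \<le> cosh S" using S by (simp add: cosh_real_abs)
    also have "\<dots> \<longleftrightarrow> \<bar>s\<bar> \<le> S" using S(1) by (intro cosh_real_nonneg_le_iff) auto
    finally show ?thesis by auto
  qed
  have s0: "-S \<le> s0" "s0 \<le> S" using iff[of s0] C0 by auto
  \<comment> \<open>An antiderivative of the integrand without the absolute value. The integral is
    \<open>2 * G s0 - G S - G (-S)\<close>, and \<open>G s0 = - l\<close> gives the second term of
    the result.\<close>
  define G where "G s = B * sinh s - A * cosh s" for s
  have G: "(G has_vector_derivative (B * cosh s - A * sinh s)) (at s within X)" for s X
    unfolding G_def has_real_derivative_iff_has_vector_derivative[symmetric]
    by (auto intro!: derivative_eq_intros)
  have form: "B * cosh s - A * sinh s = l * sinh (s0 - s)" for s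
    by (simp add: sinh_diff sinh0[symmetric] cosh0[symmetric] algebra_simps)
  have 1: "((\<lambda>s. \<bar>B * cosh s - A * sinh s\<bar>) has_integral (G s0 - G (-S))) {-S..s0}"
  proof (rule has_integral_eq)
    show "((\<lambda>s. B * cosh s - A * sinh s) has_integral (G s0 - G (-S))) {-S..s0}"
      using s0 G by (intro fundamental_theorem_of_calculus)
  qed (use l in \<open>auto simp: form\<close>)
  have 2: "((\<lambda>s. \<bar>B * cosh s - A * sinh s\<bar>) has_integral - (G S - G s0)) {s0..S}"
  proof (rule has_integral_eq)
    show "((\<lambda>s. - (B * cosh s - A * sinh s)) has_integral - (G S - G s0)) {s0..S}"
      using s0 G by (intro has_integral_neg fundamental_theorem_of_calculus)
  qed (use l in \<open>auto simp: form abs_mult\<close>)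
  have "((\<lambda>s. \<bar>B * cosh s - A * sinh s\<bar>) has_integral (G s0 - G (-S)) + - (G S - G s0)) {-S..S}"
    using s0 1 2 by (rule has_integral_combine)
  moreover have "G s0 = - l"
  proof -
    have "l * (G s0 + l) = 0"
      using l(2) sinh0 cosh0 unfolding G_def by (simp add: power2_eq_square algebra_simps)
    then show ?thesis using l by simp
  qed
  moreover have "G S + G (-S) = - 2 * A * C" using S by (simp add: G_def)
  ultimately have "((\<lambda>s. \<bar>B * cosh s - A * sinh s\<bar>) has_integral 2 * A * C - 2 * l) {-S..S}"
    by (simp add: algebra_simps)
  then have "(\<integral>\<^sup>+s. ennreal \<bar>B * cosh s - A * sinh s\<bar> * indicator {-S..S} s \<partial>lborel) = ennreal (2 * A * C - 2 * l)"
    by (intro nn_integral_has_integral_lebesgue') auto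
  moreover have "{s. cosh s \<le> C} = {-S..S}" by (rule set_eqI) (simp only: mem_Collect_eq iff)
  ultimately show ?thesis by (simp only: l_def)
qed

lemma vector_2_eq: "vector [x, y] = x *\<^sub>R axis 1 1 + (y *\<^sub>R axis 2 1 :: real^2)"
  by (simp add: vec_eq_iff forall_2 axis_def)

text \<open>\<open>lborel\<close> is characterised by its values on boxes, so it is the image of the
  product measure under the pairing map; Tonelli's theorem does the rest.\<close>

lemma nn_integral_lborel_vec2:
  fixes f :: "real^2 \<Rightarrow> ennreal"
  assumes [measurable]: "f \<in> borel_measurable borel"
  shows "(\<integral>\<^sup>+x. f x \<partial>lborel) = (\<integral>\<^sup>+t. \<integral>\<^sup>+s. f (vector [t, s]) \<partial>lborel \<partial>lborel)"
proof -
  let ?v = "\<lambda>p::real \<times> real. vector [fst p, snd p] :: real^2"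
  have B: "Basis = {axis 1 1, axis 2 (1::real) :: real^2}"
    by (auto simp: Basis_vec_def UNIV_2)
  have ne: "axis 1 1 \<noteq> (axis 2 1 :: real^2)" by (simp add: axis_eq_axis)
  have v[measurable]: "?v \<in> borel_measurable (lborel \<Otimes>\<^sub>M lborel)"
    unfolding vector_2_eq by simp
  have "lborel = distr (lborel \<Otimes>\<^sub>M lborel) borel ?v"
  proof (rule lborel_eqI)
    fix l u :: "real^2" assume "\<And>b. b \<in> Basis \<Longrightarrow> l \<bullet> b \<le> u \<bullet> b"
    from this[of "axis 1 1"] this[of "axis 2 1"]
    have le: "l $ 1 \<le> u $ 1" "l $ 2 \<le> u $ 2" by (simp_all add: B inner_axis)
    have "?v -` box l u \<inter> space (lborel \<Otimes>\<^sub>M lborel) = {l$1<..<u$1} \<times> {l$2<..<u$2}"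
      by (auto simp: mem_box_cart forall_2 space_pair_measure)
    then have "emeasure (distr (lborel \<Otimes>\<^sub>M lborel) borel ?v) (box l u) =
        emeasure (lborel \<Otimes>\<^sub>M lborel) ({l$1<..<u$1} \<times> {l$2<..<u$2})"
      by (subst emeasure_distr) auto
    also have "\<dots> = ennreal ((u$1 - l$1) * (u$2 - l$2))"
      using le by (simp add: lborel.emeasure_pair_measure_Times ennreal_mult)
    also have "(u$1 - l$1) * (u$2 - l$2) = (\<Prod>b\<in>Basis. (u - l) \<bullet> b)"
      using ne by (simp add: B inner_axis)
    finally show "emeasure (distr (lborel \<Otimes>\<^sub>M lborel) borel ?v) (box l u) = (\<Prod>b\<in>Basis. (u - l) \<bullet> b)" .
  qed simp
  then have "(\<integral>\<^sup>+x. f x \<partial>lborel) = (\<integral>\<^sup>+x. f x \<partial>distr (lborel \<Otimes>\<^sub>M lborel) borel ?v)" by simp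
  also have "\<dots> = (\<integral>\<^sup>+p. f (?v p) \<partial>(lborel \<Otimes>\<^sub>M lborel))"
    by (intro nn_integral_distr) auto
  also have "\<dots> = (\<integral>\<^sup>+t. \<integral>\<^sup>+s. f (vector [t, s]) \<partial>lborel \<partial>lborel)"
    by (subst lborel.nn_integral_fst[symmetric]) auto
  finally show ?thesis .
qed

subsection \<open>The hyperbolic area\<close>

lemma has_derivative_vector_2:
  fixes F G :: "'a::real_normed_vector \<Rightarrow> real"
  assumes "(F has_derivative F') (at x within S)" "(G has_derivative G') (at x within S)"
  shows "((\<lambda>x. vector [F x, G x] :: real^2) has_derivative (\<lambda>h. vector [F' h, G' h])) (at x within S)"
  unfolding vector_2_eq
  by (rule has_derivative_add has_derivative_scaleR_left assms)+

lemma vector_3_eq: "vector [x, y, z] = x *\<^sub>R axis 1 1 + y *\<^sub>R axis 2 1 + (z *\<^sub>R axis 3 1 :: real^3)"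
  by (simp add: vec_eq_iff forall_3 axis_def)

lemma has_derivative_vec_nth: "((\<lambda>x. x $ i) has_derivative (\<lambda>h. h $ i)) (at x within S)"
  by (simp add: bounded_linear_imp_has_derivative bounded_linear_vec_nth)

lemma borel_measurable_vec_nth[measurable]: "(\<lambda>x::real^'n. x $ i) \<in> borel_measurable borel"
  by (intro borel_measurable_continuous_onI continuous_intros)

text \<open>The third coordinate of the chart point, that is, the hyperbolic cosine of its distance
  from the apex \<open>(0, 0, 1)\<close>.\<close>

definition hyp_height :: "real^2 \<Rightarrow> real" where
  "hyp_height u = sqrt (1 + (u$1)\<^sup>2 + (u$2)\<^sup>2)"

lemma hyp_height: "hyp_height u > 0" "hyp_height u \<ge> 1" "(hyp_height u)\<^sup>2 = 1 + (u$1)\<^sup>2 + (u$2)\<^sup>2"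
proof -
  have "1 + (u$1)\<^sup>2 + (u$2)\<^sup>2 \<ge> 1" by simp
  then show "hyp_height u \<ge> 1" "(hyp_height u)\<^sup>2 = 1 + (u$1)\<^sup>2 + (u$2)\<^sup>2"
    by (simp_all add: hyp_height_def)
  then show "hyp_height u > 0" by linarith
qed

lemma hyp_chart_nth [simp]:
  "hyp_chart u $ 1 = u $ 1" "hyp_chart u $ 2 = u $ 2" "hyp_chart u $ 3 = hyp_height u"
  by (simp_all add: hyp_chart_def hyp_height_def)

lemma continuous_on_hyp_height [continuous_intros]: "continuous_on S hyp_height"
  unfolding hyp_height_def by (intro continuous_intros)

lemma hyp_height_borel [measurable]: "hyp_height \<in> borel_measurable borel"
  by (intro borel_measurable_continuous_onI continuous_intros)

lemma continuous_on_hyp_chart: "continuous_on S hyp_chart"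
proof -
  have eq: "hyp_chart = (\<lambda>u. vector [u$1, u$2, hyp_height u])"
    by (auto simp: vec_eq_iff forall_3)
  show ?thesis unfolding eq vector_3_eq by (intro continuous_intros)
qed

lemma hyp_chart_borel [measurable]: "hyp_chart \<in> borel_measurable borel"
  by (intro borel_measurable_continuous_onI continuous_on_hyp_chart)

lemma has_derivative_hyp_chart:
  "(hyp_chart has_derivative (\<lambda>h. vector [h$1, h$2, (u$1 * h$1 + u$2 * h$2) / hyp_height u])) (at u)"
proof -
  have pos: "1 + (u$1)\<^sup>2 + (u$2)\<^sup>2 > 0" by (simp add: add_pos_nonneg)
  have "((\<lambda>u. 1 + (u$1)\<^sup>2 + (u$2)\<^sup>2) has_derivative (\<lambda>h. 2 * (u$1 * h$1 + u$2 * h$2))) (at u)"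
    by (auto intro!: derivative_eq_intros has_derivative_vec_nth simp: algebra_simps)
  from DERIV_compose_FDERIV[OF DERIV_real_sqrt[OF pos] this]
  have "(hyp_height has_derivative
      (\<lambda>h. 2 * (u$1 * h$1 + u$2 * h$2) * (inverse (hyp_height u) / 2))) (at u)"
    unfolding hyp_height_def[abs_def] .
  also have "(\<lambda>h. 2 * (u$1 * h$1 + u$2 * h$2) * (inverse (hyp_height u) / 2)) =
      (\<lambda>h. (u$1 * h$1 + u$2 * h$2) / hyp_height u)"
    by (rule ext) (simp only: divide_inverse mult.commute mult.left_commute, simp)
  finally have "(hyp_height has_derivative (\<lambda>h. (u$1 * h$1 + u$2 * h$2) / hyp_height u)) (at u)" .
  then show ?thesis
    unfolding hyp_chart_def[abs_def] hyp_height_def[symmetric] vector_3_eq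
    by (intro has_derivative_add has_derivative_scaleR_left has_derivative_vec_nth)
qed

text \<open>The metric is the identity minus the rank-one matrix with entries
  \<open>u$i * u$j / (hyp_height u)\<^sup>2\<close>, so its determinant is one minus the trace of
  that matrix. Hence the area has density \<open>1 / hyp_height u\<close>.\<close>

lemma det_hyp_metric: "det (hyp_metric u) = (1 / hyp_height u)\<^sup>2"
proof -
  have fd: "frechet_derivative hyp_chart (at u) =
      (\<lambda>h. vector [h$1, h$2, (u$1 * h$1 + u$2 * h$2) / hyp_height u])"
    using frechet_derivative_at[OF has_derivative_hyp_chart] by simp
  have "det (hyp_metric u) = (1 - (u$1)\<^sup>2 / (hyp_height u)\<^sup>2) * (1 - (u$2)\<^sup>2 / (hyp_height u)\<^sup>2)
      - (u$1 * u$2 / (hyp_height u)\<^sup>2)\<^sup>2"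
    by (simp add: det_2 hyp_metric_def fd lorentz_def axis_def power2_eq_square)
  also have "\<dots> = 1 - ((u$1)\<^sup>2 + (u$2)\<^sup>2) / (hyp_height u)\<^sup>2"
    using hyp_height(1)[of u] by (simp add: field_simps)
  also have "\<dots> = ((hyp_height u)\<^sup>2 - ((u$1)\<^sup>2 + (u$2)\<^sup>2)) / (hyp_height u)\<^sup>2"
    using hyp_height(1)[of u] by (simp add: diff_divide_distrib)
  also have "\<dots> = 1 / (hyp_height u)\<^sup>2"
    by (simp add: hyp_height(3))
  finally show ?thesis by (simp add: power_divide)
qed

lemma hyp_area_eq:
  "hyp_area = distr (density lborel (\<lambda>u. ennreal (1 / hyp_height u))) borel hyp_chart"
  using hyp_height(1) by (simp add: hyp_area_def det_hyp_metric less_imp_le real_sqrt_divide)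

lemma sets_hyp_area [measurable_cong, simp]: "sets hyp_area = sets borel"
  by (simp add: hyp_area_eq)

lemma nn_integral_hyp_area:
  assumes [measurable]: "f \<in> borel_measurable borel"
  shows "(\<integral>\<^sup>+Y. f Y \<partial>hyp_area) = (\<integral>\<^sup>+u. ennreal (1 / hyp_height u) * f (hyp_chart u) \<partial>lborel)"
  by (simp add: hyp_area_eq nn_integral_distr nn_integral_density)

text \<open>The density \<open>1 / hyp_height u\<close> is positive everywhere, so area-null and
  Lebesgue-null mean the same in the chart.\<close>

lemma AE_hyp_area:
  assumes "{Y. P Y} \<in> sets borel"
  shows "(AE Y in hyp_area. P Y) \<longleftrightarrow> (AE u in lborel. P (hyp_chart u))"
proof -
  have "(AE Y in hyp_area. P Y) \<longleftrightarrow>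
      (AE u in density lborel (\<lambda>u. ennreal (1 / hyp_height u)). P (hyp_chart u))"
    unfolding hyp_area_eq using assms by (subst AE_distr_iff) auto
  then show ?thesis
    using hyp_height(1) by (simp add: AE_density)
qed

lemma hyp_chart_in_hyp_plane: "hyp_chart u \<in> hyp_plane"
  using bij_betw_hyp_chart by (auto simp: bij_betw_def)

lemma hyp_chart_in_hyp_disk: "hyp_chart u \<in> hyp_disk R \<longleftrightarrow> hyp_height u \<le> cosh R"
  using hyp_chart_in_hyp_plane hyp_height(2)[of u] by (simp add: hyp_disk_def)

text \<open>In the coordinates \<open>p\<close> and \<open>q\<close> of \<open>u\<close> along and
  across the direction \<open>\<theta>\<close>, the product is
  \<open>cosh \<phi> * p - sinh \<phi> * hyp_height u\<close>, where the height depends on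
  \<open>p\<close> as well. Solving for \<open>p\<close> exhibits the zero set as a graph over
  \<open>q\<close>, ready for the substitution \<open>q = sinh s\<close>.\<close>

lemma lorentz_de_sitter_hyp_chart_eq_0_iff:
  "lorentz (de_sitter_point \<phi> \<theta>) (hyp_chart u) = 0 \<longleftrightarrow>
    u$1 * cos \<theta> + u$2 * sin \<theta> = sinh \<phi> * sqrt (1 + (u$2 * cos \<theta> - u$1 * sin \<theta>)\<^sup>2)"
proof -
  define p where "p = u$1 * cos \<theta> + u$2 * sin \<theta>"
  define q where "q = u$2 * cos \<theta> - u$1 * sin \<theta>"
  have pq: "p\<^sup>2 + q\<^sup>2 = (u$1)\<^sup>2 + (u$2)\<^sup>2"
  proof -
    have "p\<^sup>2 + q\<^sup>2 = ((u$1)\<^sup>2 + (u$2)\<^sup>2) * ((sin \<theta>)\<^sup>2 + (cos \<theta>)\<^sup>2)"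
      unfolding p_def q_def by algebra
    then show ?thesis by simp
  qed
  have h: "(hyp_height u)\<^sup>2 = 1 + q\<^sup>2 + p\<^sup>2" using pq hyp_height(3)[of u] by simp
  define r where "r = sqrt (1 + q\<^sup>2)"
  have r: "r > 0" "r\<^sup>2 = 1 + q\<^sup>2" by (simp_all add: r_def add_pos_nonneg)
  have "lorentz (de_sitter_point \<phi> \<theta>) (hyp_chart u) = cosh \<phi> * p - sinh \<phi> * hyp_height u"
    by (simp add: lorentz_def de_sitter_point_def p_def algebra_simps)
  moreover have "cosh \<phi> * p = sinh \<phi> * hyp_height u \<longleftrightarrow> p = sinh \<phi> * r"
  proof
    assume eq: "cosh \<phi> * p = sinh \<phi> * hyp_height u"
    then have "(cosh \<phi> * p)\<^sup>2 = (sinh \<phi> * hyp_height u)\<^sup>2" by simp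
    then have "p\<^sup>2 = (sinh \<phi> * r)\<^sup>2"
      unfolding power_mult_distrib h r cosh_square_eq by (simp add: algebra_simps)
    \<comment> \<open>Squaring also admits the opposite sign of \<open>p\<close>. It contradicts
      \<open>eq\<close> by positivity of the height unless \<open>sinh \<phi> = 0\<close>, and then
      both signs give \<open>p = 0\<close>.\<close>
    moreover have "p = - (sinh \<phi> * r) \<Longrightarrow> sinh \<phi> = 0"
    proof (rule ccontr)
      assume p: "p = - (sinh \<phi> * r)" and "sinh \<phi> \<noteq> 0"
      with eq have "sinh \<phi> * (hyp_height u + cosh \<phi> * r) = 0" by (simp add: algebra_simps)
      with \<open>sinh \<phi> \<noteq> 0\<close> have "hyp_height u + cosh \<phi> * r = 0" by simp
      moreover have "cosh \<phi> * r > 0" using r(1) by simp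
      ultimately show False using hyp_height(1)[of u] by linarith
    qed
    ultimately show "p = sinh \<phi> * r" by (auto simp: power2_eq_iff)
  next
    assume p: "p = sinh \<phi> * r"
    have "(hyp_height u)\<^sup>2 = (cosh \<phi> * r)\<^sup>2"
      unfolding h p power_mult_distrib r cosh_square_eq by (simp add: algebra_simps)
    then have "hyp_height u = cosh \<phi> * r"
      using r(1) hyp_height(1)[of u] cosh_real_pos[of \<phi>] by (simp add: power2_eq_iff_nonneg)
    then show "cosh \<phi> * p = sinh \<phi> * hyp_height u" using p by simp
  qed
  ultimately show ?thesis by (simp add: p_def q_def r_def)
qed

subsection \<open>The Crofton formula for an arc\<close>

lemma ecard_bij_betw: "bij_betw f A B \<Longrightarrow> ecard A = ecard B"
  by (simp add: emeasure_count_space bij_betw_finite bij_betw_same_card)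

lemma rotation_eq_iff:
  fixes p q x y t :: real
  shows "p * cos t - q * sin t = x \<and> p * sin t + q * cos t = y \<longleftrightarrow>
    p = x * cos t + y * sin t \<and> q = y * cos t - x * sin t"
proof (safe)
  have *: "(sin t)\<^sup>2 + (cos t)\<^sup>2 = 1" by simp
  let ?x = "p * cos t - q * sin t" and ?y = "p * sin t + q * cos t"
  show "p = ?x * cos t + ?y * sin t" "q = ?y * cos t - ?x * sin t"
    using * by algebra+
  let ?p = "x * cos t + y * sin t" and ?q = "y * cos t - x * sin t"
  show "?p * cos t - ?q * sin t = x" "?p * sin t + ?q * cos t = y"
    using * by algebra+
qed

text \<open>The point at signed distance \<open>s\<close> on the geodesic of \<^const>\<open>hyp_plane\<close> orthogonal to
  \<open>de_sitter_point \<phi> \<theta>\<close>, in the chart \<^const>\<open>hyp_chart\<close>; the base point is the one closest to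
  the apex.\<close>

definition polar_line :: "real \<Rightarrow> real \<Rightarrow> real \<Rightarrow> real^2" where
  "polar_line \<phi> \<theta> s = vector [cosh s * sinh \<phi> * cos \<theta> - sinh s * sin \<theta>,
                                cosh s * sinh \<phi> * sin \<theta> + sinh s * cos \<theta>]"

text \<open>The hyperbolic Pythagorean theorem: the base point \<open>s = 0\<close> lies at distance
  \<open>\<bar>\<phi>\<bar>\<close> from the apex, and the geodesic meets the radius to that point
  at a right angle.\<close>

lemma hyp_height_polar_line: "hyp_height (polar_line \<phi> \<theta> s) = cosh s * cosh \<phi>"
proof -
  have "(hyp_height (polar_line \<phi> \<theta> s))\<^sup>2 =
      1 + ((cosh s * sinh \<phi>)\<^sup>2 + (sinh s)\<^sup>2) * ((sin \<theta>)\<^sup>2 + (cos \<theta>)\<^sup>2)"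
    unfolding hyp_height(3) polar_line_def
    by (simp del: sin_cos_squared_add sin_cos_squared_add2) algebra
  also have "\<dots> = (cosh s * cosh \<phi>)\<^sup>2"
    by (simp add: power_mult_distrib cosh_square_eq algebra_simps)
  finally show ?thesis
    using hyp_height(1)[of "polar_line \<phi> \<theta> s"] by (simp add: power2_eq_iff_nonneg)
qed

text \<open>Undoing the rotation by \<open>\<theta>\<close> turns the coordinates of
  \<open>polar_line\<close> into \<open>cosh s * sinh \<phi>\<close> and \<open>sinh s\<close>. As
  the point determines \<open>s\<close>, each crossing parameter \<open>t\<close> corresponds to
  exactly one preimage \<open>(t, s)\<close>, which lets the area formula count crossings.\<close>

lemma polar_line_eq_iff:
  "polar_line \<phi> \<theta> s = u \<longleftrightarrow>
    lorentz (de_sitter_point \<phi> \<theta>) (hyp_chart u) = 0 \<and> s = arsinh (u$2 * cos \<theta> - u$1 * sin \<theta>)"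
proof -
  have "polar_line \<phi> \<theta> s = u \<longleftrightarrow> cosh s * sinh \<phi> = u$1 * cos \<theta> + u$2 * sin \<theta> \<and>
      sinh s = u$2 * cos \<theta> - u$1 * sin \<theta>"
    unfolding rotation_eq_iff[symmetric] by (simp add: polar_line_def vec_eq_iff forall_2)
  moreover have "sinh s = q \<longleftrightarrow> s = arsinh q" for q :: real
    using arsinh_sinh_real sinh_arsinh_real by metis
  moreover have "cosh (arsinh q) = sqrt (1 + q\<^sup>2)" for q :: real
    by (simp add: cosh_arsinh_real add.commute)
  ultimately show ?thesis
    unfolding lorentz_de_sitter_hyp_chart_eq_0_iff by (metis mult.commute)
qed

text \<open>The factor \<open>cosh s * cosh \<alpha>\<close> of the determinant is the height of the
  image point. It cancels against the density of the area, which leaves the Jacobian with respect to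
  hyperbolic area.\<close>

lemma
  fixes \<phi> \<theta> :: "real \<Rightarrow> real"
  assumes \<phi>': "(\<phi> has_real_derivative \<phi>') (at (x$1))" and \<theta>': "(\<theta> has_real_derivative \<theta>') (at (x$1))"
  defines "\<alpha> \<equiv> \<phi> (x$1)" and "\<beta> \<equiv> \<theta> (x$1)" and "s \<equiv> x$2"
  defines "J \<equiv> vector
     [vector [cosh s * (cosh \<alpha> * \<phi>' * cos \<beta> - sinh \<alpha> * sin \<beta> * \<theta>') - sinh s * cos \<beta> * \<theta>',
              sinh s * sinh \<alpha> * cos \<beta> - cosh s * sin \<beta>],
      vector [cosh s * (cosh \<alpha> * \<phi>' * sin \<beta> + sinh \<alpha> * cos \<beta> * \<theta>') - sinh s * sin \<beta> * \<theta>',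
              sinh s * sinh \<alpha> * sin \<beta> + cosh s * cos \<beta>]] :: real^2^2"
  shows has_derivative_polar_line:
      "((\<lambda>x. polar_line (\<phi> (x$1)) (\<theta> (x$1)) (x$2)) has_derivative (*v) J) (at x)"
    and det_polar_line: "det J = cosh s * cosh \<alpha> * (\<phi>' * cosh s - \<theta>' * cosh \<alpha> * sinh s)"
proof -
  have d1: "((\<lambda>x. F (G (x$1))) has_derivative (\<lambda>h. h$1 * (F' * G'))) (at x)"
    if "(G has_real_derivative G') (at (x$1))" "(F has_real_derivative F') (at (G (x$1)))" for F G F' G'
    using DERIV_compose_FDERIV[OF DERIV_chain2[OF that(2,1)] has_derivative_vec_nth] .
  have d2: "((\<lambda>x. F (x$2)) has_derivative (\<lambda>h. h$2 * F')) (at x)"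
    if "(F has_real_derivative F') (at (x$2))" for F F'
    using DERIV_compose_FDERIV[OF that has_derivative_vec_nth] .
  have cosh: "(cosh has_real_derivative sinh y) (at y)" and sinh: "(sinh has_real_derivative cosh y) (at y)"
    for y :: real by (auto intro!: derivative_eq_intros)
  note D = d2[OF cosh] d2[OF sinh] d1[OF \<phi>' sinh]
    d1[OF \<theta>' DERIV_sin] d1[OF \<theta>' DERIV_cos]
  show "((\<lambda>x. polar_line (\<phi> (x$1)) (\<theta> (x$1)) (x$2)) has_derivative (*v) J) (at x)"
    unfolding polar_line_def
    by (rule has_derivative_eq_rhs,
        (rule has_derivative_vector_2 has_derivative_diff has_derivative_add has_derivative_mult D)+)
      (simp add: fun_eq_iff vec_eq_iff forall_2 matrix_vector_mult_def sum_2 J_def \<alpha>_def \<beta>_def s_def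
        algebra_simps)
  have "det J = cosh s * cosh \<alpha> * \<phi>' * cosh s * ((sin \<beta>)\<^sup>2 + (cos \<beta>)\<^sup>2)
      - \<theta>' * sinh s * cosh s * (1 + (sinh \<alpha>)\<^sup>2) * ((sin \<beta>)\<^sup>2 + (cos \<beta>)\<^sup>2)"
    unfolding det_2 J_def
    by (simp del: sin_cos_squared_add sin_cos_squared_add2) algebra
  also have "\<dots> = cosh s * cosh \<alpha> * (\<phi>' * cosh s - \<theta>' * cosh \<alpha> * sinh s)"
  proof -
    have c: "1 + (sinh \<alpha>)\<^sup>2 = (cosh \<alpha>)\<^sup>2" by (simp add: cosh_square_eq)
    show ?thesis unfolding c by (simp add: algebra_simps power2_eq_square)
  qed
  finally show "det J = cosh s * cosh \<alpha> * (\<phi>' * cosh s - \<theta>' * cosh \<alpha> * sinh s)" .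
qed

lemma continuous_on_vector_2:
  fixes F G :: "'a::topological_space \<Rightarrow> 'b::{topological_space, zero}"
  assumes "continuous_on S F" "continuous_on S G"
  shows "continuous_on S (\<lambda>x. vector [F x, G x] :: 'b^2)"
proof -
  have "(\<lambda>x. vector [F x, G x] :: 'b^2) = (\<lambda>x. \<chi> i. if i = 1 then F x else G x)"
    by (auto simp: vec_eq_iff forall_2)
  moreover have "continuous_on S (\<lambda>x. if i = 1 then F x else G x)" for i :: 2
    using assms by (cases "i = 1") simp_all
  ultimately show ?thesis by (simp only: continuous_on_vec_lambda)
qed

text \<open>The Jacobian of the polar map changes sign where \<open>s\<close> gives the pole of the
  geodesic tangent to the curve at \<open>t\<close>. The quotient in the assumption on
  \<open>R\<close> is the height of that pole, so the assumption puts all tangent poles into the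
  disk. The inner integral then has a closed form, and integrating it over \<open>t\<close> produces
  the longitude difference and the length.\<close>

lemma crofton_arc:
  fixes \<phi> \<theta> \<phi>' \<theta>' :: "real \<Rightarrow> real" and c d R :: real
  assumes cd: "c < d"
    and \<phi>': "\<And>t. t \<in> {c<..<d} \<Longrightarrow> (\<phi> has_real_derivative \<phi>' t) (at t)"
    and \<theta>': "\<And>t. t \<in> {c<..<d} \<Longrightarrow> (\<theta> has_real_derivative \<theta>' t) (at t)"
    and cont: "continuous_on {c..d} \<phi>" "continuous_on {c..d} \<theta>"
      "continuous_on {c..d} \<phi>'" "continuous_on {c..d} \<theta>'"
    and spacelike: "\<And>t. t \<in> {c..d} \<Longrightarrow> \<bar>\<phi>' t\<bar> < \<theta>' t * cosh (\<phi> t)"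
    and R: "\<And>t. t \<in> {c..d} \<Longrightarrow>
      \<theta>' t * (cosh (\<phi> t))\<^sup>2 / sqrt ((\<theta>' t * cosh (\<phi> t))\<^sup>2 - (\<phi>' t)\<^sup>2) \<le> cosh R"
  defines "I \<equiv> 2 * (\<theta> d - \<theta> c) * cosh R -
      2 * integral {c..d} (\<lambda>t. sqrt ((\<theta>' t * cosh (\<phi> t))\<^sup>2 - (\<phi>' t)\<^sup>2))"
  shows "0 \<le> I"
    and "(\<integral>\<^sup>+u. ennreal (1 / hyp_height u) * indicator {u. hyp_height u \<le> cosh R} u *
      ecard {t \<in> {c<..<d}. lorentz (de_sitter_point (\<phi> t) (\<theta> t)) (hyp_chart u) = 0} \<partial>lborel) = ennreal I"
proof -
  let ?I = "{c<..<d}"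
  \<comment> \<open>These extensions by 0 are Borel on the whole line, as the iterated integral
    requires.\<close>
  define \<Phi> where "\<Phi> t = (if t \<in> ?I then \<phi> t else 0)" for t
  define \<Phi>' where "\<Phi>' t = (if t \<in> ?I then \<phi>' t else 0)" for t
  define \<Theta>' where "\<Theta>' t = (if t \<in> ?I then \<theta>' t else 0)" for t
  have [measurable]: "\<Phi> \<in> borel_measurable borel" "\<Phi>' \<in> borel_measurable borel" "\<Theta>' \<in> borel_measurable borel"
    unfolding \<Phi>_def \<Phi>'_def \<Theta>'_def
    by (intro borel_measurable_continuous_on_if; auto intro: continuous_on_subset[OF cont(1)]
        continuous_on_subset[OF cont(3)] continuous_on_subset[OF cont(4)])+
  have [measurable]: "cosh \<in> borel_measurable (borel :: real measure)" "sinh \<in> borel_measurable (borel :: real measure)"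
    by (intro borel_measurable_continuous_onI continuous_intros)+
  define S where "S = {x :: real^2. x $ 1 \<in> ?I}"
  define f where "f x = polar_line (\<phi> (x$1)) (\<theta> (x$1)) (x$2)" for x :: "real^2"
  define J where "J x = (vector
     [vector [cosh (x$2) * (cosh (\<phi> (x$1)) * \<phi>' (x$1) * cos (\<theta> (x$1)) - sinh (\<phi> (x$1)) * sin (\<theta> (x$1)) * \<theta>' (x$1))
                - sinh (x$2) * cos (\<theta> (x$1)) * \<theta>' (x$1),
              sinh (x$2) * sinh (\<phi> (x$1)) * cos (\<theta> (x$1)) - cosh (x$2) * sin (\<theta> (x$1))],
      vector [cosh (x$2) * (cosh (\<phi> (x$1)) * \<phi>' (x$1) * sin (\<theta> (x$1)) + sinh (\<phi> (x$1)) * cos (\<theta> (x$1)) * \<theta>' (x$1))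
                - sinh (x$2) * sin (\<theta> (x$1)) * \<theta>' (x$1),
              sinh (x$2) * sinh (\<phi> (x$1)) * sin (\<theta> (x$1)) + cosh (x$2) * cos (\<theta> (x$1))]] :: real^2^2)"
    for x :: "real^2"
  have J1: "(f has_derivative (*v) (J x)) (at x)"
    and J2: "det (J x) = cosh (x$2) * cosh (\<phi> (x$1)) *
      (\<phi>' (x$1) * cosh (x$2) - \<theta>' (x$1) * cosh (\<phi> (x$1)) * sinh (x$2))" if "x \<in> S" for x
    using has_derivative_polar_line[OF \<phi>' \<theta>', of x] det_polar_line[OF \<phi>' \<theta>', of x] that
    by (auto simp: f_def[abs_def] J_def S_def)
  have "S = (\<lambda>x. x $ 1) -` ?I" by (auto simp: S_def)
  then have S: "open S" by (auto intro!: open_vimage continuous_intros)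
  have sub: "(\<lambda>x. x $ 1) ` S \<subseteq> {c..d}" by (auto simp: S_def)
  have "continuous_on S (\<lambda>x. \<phi> (x$1))" "continuous_on S (\<lambda>x. \<theta> (x$1))"
    "continuous_on S (\<lambda>x. \<phi>' (x$1))" "continuous_on S (\<lambda>x. \<theta>' (x$1))"
    by (rule continuous_on_compose2[OF _ _ sub], intro cont, intro continuous_intros)+
  note c = this
  have J3: "continuous_on S J"
    unfolding J_def by (intro continuous_on_vector_2 continuous_intros c)
  define w where "w u = ennreal (1 / hyp_height u) * indicator {u. hyp_height u \<le> cosh R} u" for u
  have [measurable]: "w \<in> borel_measurable borel" unfolding w_def by measurable
  have count: "ecard {t \<in> ?I. lorentz (de_sitter_point (\<phi> t) (\<theta> t)) (hyp_chart u) = 0} =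
      ecard {x \<in> S. f x = u}" for u
  proof (rule ecard_bij_betw)
    show "bij_betw (\<lambda>t. vector [t, arsinh (u$2 * cos (\<theta> t) - u$1 * sin (\<theta> t))])
      {t \<in> ?I. lorentz (de_sitter_point (\<phi> t) (\<theta> t)) (hyp_chart u) = 0} {x \<in> S. f x = u}"
      by (rule bij_betwI[where g = "\<lambda>x. x $ 1"])
        (auto simp: S_def f_def polar_line_eq_iff vec_eq_iff[of "vector _"] forall_2)
  qed
  \<comment> \<open>The integrand after the height has cancelled; its indicator is the disk
    condition in the form given by \<open>hyp_height_polar_line\<close>.\<close>
  define k where "k t s = ennreal \<bar>\<Phi>' t * cosh s - \<Theta>' t * cosh (\<Phi> t) * sinh s\<bar> *
    indicator {(t, s). cosh s * cosh (\<Phi> t) \<le> cosh R} (t, s) * indicator ?I t" for t s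
  define l where "l t = sqrt ((\<theta>' t * cosh (\<phi> t))\<^sup>2 - (\<phi>' t)\<^sup>2)" for t
  have lpos: "l t > 0" if "t \<in> {c..d}" for t
  proof -
    have "(\<phi>' t)\<^sup>2 < (\<theta>' t * cosh (\<phi> t))\<^sup>2"
      using power_strict_mono[OF spacelike[OF that], of 2] by simp
    then show ?thesis by (simp add: l_def)
  qed
  have inner: "(\<integral>\<^sup>+s. k t s \<partial>lborel) = ennreal (2 * \<theta>' t * cosh R - 2 * l t) * indicator ?I t" for t
  proof (cases "t \<in> ?I")
    case True
    then have t: "t \<in> {c..d}" by auto
    \<comment> \<open>\<open>?C\<close> is the bound that the disk puts on \<open>cosh s\<close>.
      Multiplied by \<open>?A\<close> it loses the factor \<open>cosh (\<phi> t)\<close>, so the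
      first term of the result involves only \<open>\<theta>' t\<close> and
      \<open>cosh R\<close>.\<close>
    let ?A = "\<theta>' t * cosh (\<phi> t)" and ?C = "cosh R / cosh (\<phi> t)"
    have "(\<integral>\<^sup>+s. k t s \<partial>lborel) =
        (\<integral>\<^sup>+s. ennreal \<bar>\<phi>' t * cosh s - ?A * sinh s\<bar> * indicator {s. cosh s \<le> ?C} s \<partial>lborel)"
      using True by (intro nn_integral_cong)
        (auto simp: k_def \<Phi>_def \<Phi>'_def \<Theta>'_def indicator_def pos_le_divide_eq)
    also have "\<dots> = ennreal (2 * ?A * ?C - 2 * sqrt (?A\<^sup>2 - (\<phi>' t)\<^sup>2))"
    proof (rule nn_integral_abs_cosh_sinh)
      show "\<bar>\<phi>' t\<bar> < ?A" by (rule spacelike[OF t])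
      show "?A / sqrt (?A\<^sup>2 - (\<phi>' t)\<^sup>2) \<le> ?C"
        using R[OF t] by (simp add: pos_le_divide_eq power2_eq_square mult.assoc)
    qed
    also have "2 * ?A * ?C = 2 * \<theta>' t * cosh R" by simp
    finally show ?thesis using True by (simp add: l_def)
  qed (simp add: k_def)
  \<comment> \<open>\<open>ennreal\<close> sends negative reals to 0, so the sign matters. The speed
    \<open>l t\<close> is at most \<open>?A * ?A / l t\<close>, which the assumption on
    \<open>R\<close> bounds by \<open>\<theta>' t * cosh R\<close>.\<close>
  have nonneg: "0 \<le> 2 * \<theta>' t * cosh R - 2 * l t" if "t \<in> {c..d}" for t
  proof -
    let ?A = "\<theta>' t * cosh (\<phi> t)"
    have A: "\<bar>\<phi>' t\<bar> < ?A" by (rule spacelike[OF that])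
    have "l t * l t \<le> ?A * ?A"
      using lpos[OF that] by (simp add: l_def power2_eq_square)
    then have "l t \<le> ?A * ?A / l t" using lpos[OF that] by (simp add: pos_le_divide_eq)
    also have "\<dots> = \<theta>' t * (\<theta>' t * (cosh (\<phi> t))\<^sup>2 / l t)" by (simp add: power2_eq_square)
    also have "\<dots> \<le> \<theta>' t * cosh R"
    proof (rule mult_left_mono)
      show "\<theta>' t * (cosh (\<phi> t))\<^sup>2 / l t \<le> cosh R" using R[OF that] by (simp add: l_def)
      have "0 < ?A" using A by linarith
      then show "0 \<le> \<theta>' t"
        using zero_less_mult_pos2[OF _ cosh_real_pos] less_imp_le by blast
    qed
    finally show ?thesis by simp
  qed
  have int: "((\<lambda>t. 2 * \<theta>' t * cosh R - 2 * l t) has_integral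
      (2 * (\<theta> d - \<theta> c) * cosh R - 2 * integral {c..d} l)) {c..d}"
  proof -
    have "(\<theta>' has_integral (\<theta> d - \<theta> c)) {c..d}"
      using cd cont \<theta>' by (intro fundamental_theorem_of_calculus_interior)
        (auto simp: has_real_derivative_iff_has_vector_derivative)
    moreover have "(l has_integral integral {c..d} l) {c..d}"
      unfolding l_def by (intro integrable_integral integrable_continuous_interval continuous_intros cont)
    ultimately have "((\<lambda>t. \<theta>' t * (2 * cosh R) - l t * 2) has_integral
        ((\<theta> d - \<theta> c) * (2 * cosh R) - integral {c..d} l * 2)) {c..d}"
      by (intro has_integral_diff has_integral_mult_left)
    then show ?thesis by (simp add: algebra_simps)
  qed
  have "(\<integral>\<^sup>+u. w u * ecard {x \<in> S. f x = u} \<partial>lborel) =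
      (\<integral>\<^sup>+x. w (f x) * ennreal \<bar>det (J x)\<bar> * indicator S x \<partial>lborel)"
    by (intro nn_integral_area_formula S J1 J3) auto
  also have "\<dots> = (\<integral>\<^sup>+x. k (x$1) ((x :: real^2)$2) \<partial>lborel)"
  proof (intro nn_integral_cong)
    fix x :: "real^2"
    show "w (f x) * ennreal \<bar>det (J x)\<bar> * indicator S x = k (x$1) (x$2)"
    proof (cases "x \<in> S")
      case True
      then have x: "x$1 \<in> ?I" by (simp add: S_def)
      have h: "hyp_height (f x) = cosh (x$2) * cosh (\<phi> (x$1))"
        by (simp add: f_def hyp_height_polar_line)
      have "ennreal (1 / hyp_height (f x)) * ennreal \<bar>det (J x)\<bar> =
          ennreal \<bar>\<phi>' (x$1) * cosh (x$2) - \<theta>' (x$1) * cosh (\<phi> (x$1)) * sinh (x$2)\<bar>"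
        unfolding h J2[OF True] by (subst ennreal_mult[symmetric]) (auto simp: abs_mult)
      then show ?thesis
        using True x by (auto simp: w_def k_def h \<Phi>_def \<Phi>'_def \<Theta>'_def indicator_def)
    qed (auto simp: k_def S_def)
  qed
  also have "\<dots> = (\<integral>\<^sup>+t. \<integral>\<^sup>+s. k t s \<partial>lborel \<partial>lborel)"
  proof -
    have "(\<lambda>x. k (x$1) ((x :: real^2)$2)) \<in> borel_measurable borel"
      unfolding k_def by measurable
    then show ?thesis by (simp add: nn_integral_lborel_vec2)
  qed
  also have "\<dots> = (\<integral>\<^sup>+t. ennreal (2 * \<theta>' t * cosh R - 2 * l t) * indicator ?I t \<partial>lborel)"
    by (simp add: inner)
  also have "\<dots> = ennreal (2 * (\<theta> d - \<theta> c) * cosh R - 2 * integral {c..d} l)"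
    using nonneg int by (intro nn_integral_has_integral_lebesgue') (auto simp: has_integral_Icc_iff_Ioo)
  finally show "(\<integral>\<^sup>+u. ennreal (1 / hyp_height u) * indicator {u. hyp_height u \<le> cosh R} u *
      ecard {t \<in> ?I. lorentz (de_sitter_point (\<phi> t) (\<theta> t)) (hyp_chart u) = 0} \<partial>lborel) = ennreal I"
    unfolding count w_def l_def I_def .
  show "0 \<le> I"
    using has_integral_nonneg[OF int nonneg] unfolding I_def l_def .
qed

section \<open>Measurability of the crossing count and a null set of poles\<close>

lemma borel_measurable_ecard_crossings:
  fixes \<Gamma> :: "real \<Rightarrow> real^3"
  assumes "continuous_on {a..b} \<Gamma>"
  shows "(\<lambda>Y. ecard {t \<in> {a..<b}. lorentz (\<Gamma> t) Y = 0}) \<in> borel_measurable borel"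
proof (rule borel_measurable_ecard_zeros[where h = "\<lambda>t Y. lorentz (\<Gamma> t) Y"])
  have c: "continuous_on ({a..b} \<times> UNIV) (\<lambda>p. \<Gamma> (fst p))"
    by (rule continuous_on_compose2[OF assms]) (auto intro!: continuous_intros)
  show "continuous_on ({a..b} \<times> UNIV) (\<lambda>(t, Y). lorentz (\<Gamma> t) Y)"
    unfolding lorentz_def case_prod_beta by (intro continuous_intros c)
qed

text \<open>The excluded points form a single geodesic, the image of a coordinate line under a
  differentiable map of the plane to itself, hence a null set. Single parameter values such as the
  end of an arc can thereby be disregarded.\<close>

lemma AE_lorentz_hyp_chart_nonzero:
  "AE u in lborel. lorentz (de_sitter_point \<phi> \<theta>) (hyp_chart u) \<noteq> 0"
proof -
  let ?H = "{x :: real^2. x $ 1 = 0}" and ?f = "\<lambda>x::real^2. polar_line \<phi> \<theta> (x $ 2)"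
  have "negligible (?f ` ?H)"
  proof (rule negligible_differentiable_image_negligible)
    show "negligible ?H" by (rule negligible_standard_hyperplane_cart)
    have "?f differentiable (at x)" for x
      using has_derivative_polar_line[of "\<lambda>_. \<phi>" 0 x "\<lambda>_. \<theta>" 0] by (auto simp: differentiable_def)
    then show "?f differentiable_on ?H"
      by (simp add: differentiable_at_imp_differentiable_on)
  qed simp
  then have "AE u in lebesgue. u \<notin> ?f ` ?H"
    by (simp add: negligible_iff_null_sets AE_not_in)
  then have "AE u in lborel. u \<notin> ?f ` ?H"
    by (simp only: AE_completion_iff)
  then show ?thesis
  proof eventually_elim
    case (elim u)
    show ?case
    proof
      assume "lorentz (de_sitter_point \<phi> \<theta>) (hyp_chart u) = 0"
      then have "polar_line \<phi> \<theta> (arsinh (u$2 * cos \<theta> - u$1 * sin \<theta>)) = u"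
        by (simp add: polar_line_eq_iff)
      then have "u \<in> ?f ` ?H"
        by (intro image_eqI[of _ _ "vector [0, arsinh (u$2 * cos \<theta> - u$1 * sin \<theta>)]"]) auto
      with elim show False by contradiction
    qed
  qed
qed

section \<open>Smooth pieces in latitude and longitude\<close>

text \<open>The latitude is \<open>arsinh\<close> of the third coordinate and inherits its
  differentiability. For the longitude a positive derivative is given only pointwise; its continuity
  comes from solving the velocity components for it. The squared speed is \<open>(\<theta>' t * cosh
  (\<phi> t))\<^sup>2 - (\<phi>' t)\<^sup>2\<close>, which turns spacelikeness into the strict
  inequality.\<close>

lemma polar_derivatives_of_piece:
  fixes \<Gamma> :: "real \<Rightarrow> real^3" and \<theta> :: "real \<Rightarrow> real"
  assumes cd: "c < d" and smooth: "smooth_piece c d \<Gamma>"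
    and space: "\<And>t. t \<in> {c..d} \<Longrightarrow> let v = vector_derivative \<Gamma> (at t within {c..d}) in lorentz v v > 0"
    and lon: "\<And>t. t \<in> {c..d} \<Longrightarrow> \<exists>\<phi>. \<Gamma> t = de_sitter_point \<phi> (\<theta> t)"
    and incr: "\<And>t. t \<in> {c..d} \<Longrightarrow> \<exists>D>0. (\<theta> has_real_derivative D) (at t within {c..d})"
  obtains \<phi> \<phi>' \<theta>' where
    "\<And>t. t \<in> {c..d} \<Longrightarrow> \<Gamma> t = de_sitter_point (\<phi> t) (\<theta> t)"
    "\<And>t. t \<in> {c..d} \<Longrightarrow> (\<phi> has_real_derivative \<phi>' t) (at t within {c..d})"
    "\<And>t. t \<in> {c..d} \<Longrightarrow> (\<theta> has_real_derivative \<theta>' t) (at t within {c..d})"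
    "continuous_on {c..d} \<phi>'" "continuous_on {c..d} \<theta>'"
    "\<And>t. t \<in> {c..d} \<Longrightarrow> \<bar>\<phi>' t\<bar> < \<theta>' t * cosh (\<phi> t)"
    "\<And>t. t \<in> {c<..<d} \<Longrightarrow> lorentz (vector_derivative \<Gamma> (at t)) (vector_derivative \<Gamma> (at t)) =
      (\<theta>' t * cosh (\<phi> t))\<^sup>2 - (\<phi>' t)\<^sup>2"
proof -
  let ?I = "{c..d}"
  obtain D where D0: "\<And>t. t \<in> ?I \<Longrightarrow> D 0 t = \<Gamma> t"
    and DS: "\<And>k t. t \<in> ?I \<Longrightarrow> (D k has_vector_derivative D (Suc k) t) (at t within ?I)"
    using smooth unfolding smooth_piece_def by blast
  define V where "V = D (Suc 0)"
  have V: "(\<Gamma> has_vector_derivative V t) (at t within ?I)" if "t \<in> ?I" for t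
    unfolding V_def by (rule has_vector_derivative_transform[OF that _ DS[OF that, of 0]]) (simp add: D0)
  have contV: "continuous_on ?I V"
    using DS unfolding V_def by (intro continuous_on_vector_derivative)
  have Vn: "((\<lambda>t. \<Gamma> t $ i) has_real_derivative V t $ i) (at t within ?I)" if "t \<in> ?I" for t i
    using bounded_linear.has_vector_derivative[OF bounded_linear_vec_nth V[OF that]]
    by (simp add: has_real_derivative_iff_has_vector_derivative)
  obtain T where T: "\<And>t. t \<in> ?I \<Longrightarrow> T t > 0"
      "\<And>t. t \<in> ?I \<Longrightarrow> (\<theta> has_real_derivative T t) (at t within ?I)"
    using incr by metis
  define \<phi> where "\<phi> t = arsinh (\<Gamma> t $ 3)" for t
  define \<phi>' where "\<phi>' t = V t $ 3 / cosh (\<phi> t)" for t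
  have G: "\<Gamma> t = de_sitter_point (\<phi> t) (\<theta> t)" if "t \<in> ?I" for t
    using lon[OF that] by (auto simp: \<phi>_def de_sitter_point_def arsinh_sinh_real)
  then have G12: "\<Gamma> t $ 1 = cosh (\<phi> t) * cos (\<theta> t)" "\<Gamma> t $ 2 = cosh (\<phi> t) * sin (\<theta> t)" if "t \<in> ?I" for t
    using that by (auto simp: de_sitter_point_def)
  have \<phi>': "(\<phi> has_real_derivative \<phi>' t) (at t within ?I)" if "t \<in> ?I" for t
    unfolding \<phi>_def[abs_def] \<phi>'_def
    using DERIV_chain2[OF arsinh_real_has_field_derivative Vn[OF that, of 3]]
    by (simp add: cosh_arsinh_real)
  \<comment> \<open>Since \<open>c < d\<close>, one-sided derivatives at the endpoints are unique as
    well, so the product rule can be compared with the velocity components.\<close>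
  have uniq: "x = y" if "t \<in> ?I" "(F has_real_derivative x) (at t within ?I)"
    "(F has_real_derivative y) (at t within ?I)" for F x y and t
    using vector_derivative_unique_within[of t ?I F x y] that cd
    by (auto simp: has_real_derivative_iff_has_vector_derivative trivial_limit_within islimpt_Icc)
  have V1: "V t $ 1 = sinh (\<phi> t) * \<phi>' t * cos (\<theta> t) - cosh (\<phi> t) * sin (\<theta> t) * T t"
    and V2: "V t $ 2 = sinh (\<phi> t) * \<phi>' t * sin (\<theta> t) + cosh (\<phi> t) * cos (\<theta> t) * T t" if t: "t \<in> ?I" for t
  proof -
    have "((\<lambda>t. cosh (\<phi> t) * cos (\<theta> t)) has_real_derivative
        (sinh (\<phi> t) * \<phi>' t * cos (\<theta> t) - cosh (\<phi> t) * sin (\<theta> t) * T t)) (at t within ?I)"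
      using \<phi>'[OF t] T(2)[OF t] by (auto intro!: derivative_eq_intros)
    moreover have "((\<lambda>t. cosh (\<phi> t) * cos (\<theta> t)) has_real_derivative V t $ 1) (at t within ?I)"
      using Vn[OF t, of 1] t G12(1) by (subst has_field_derivative_cong_eventually[symmetric])
        (auto simp: eventually_at_filter)
    ultimately show "V t $ 1 = sinh (\<phi> t) * \<phi>' t * cos (\<theta> t) - cosh (\<phi> t) * sin (\<theta> t) * T t"
      using uniq[OF t] by blast
    have "((\<lambda>t. cosh (\<phi> t) * sin (\<theta> t)) has_real_derivative
        (sinh (\<phi> t) * \<phi>' t * sin (\<theta> t) + cosh (\<phi> t) * cos (\<theta> t) * T t)) (at t within ?I)"
      using \<phi>'[OF t] T(2)[OF t] by (auto intro!: derivative_eq_intros)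
    moreover have "((\<lambda>t. cosh (\<phi> t) * sin (\<theta> t)) has_real_derivative V t $ 2) (at t within ?I)"
      using Vn[OF t, of 2] t G12(2) by (subst has_field_derivative_cong_eventually[symmetric])
        (auto simp: eventually_at_filter)
    ultimately show "V t $ 2 = sinh (\<phi> t) * \<phi>' t * sin (\<theta> t) + cosh (\<phi> t) * cos (\<theta> t) * T t"
      using uniq[OF t] by blast
  qed
  have V3: "V t $ 3 = cosh (\<phi> t) * \<phi>' t" for t by (simp add: \<phi>'_def)
  have lor: "lorentz (V t) (V t) = (T t * cosh (\<phi> t))\<^sup>2 - (\<phi>' t)\<^sup>2" if t: "t \<in> ?I" for t
  proof -
    have "lorentz (V t) (V t) = ((sinh (\<phi> t) * \<phi>' t)\<^sup>2 + (cosh (\<phi> t) * T t)\<^sup>2) *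
        ((sin (\<theta> t))\<^sup>2 + (cos (\<theta> t))\<^sup>2) - (cosh (\<phi> t) * \<phi>' t)\<^sup>2"
      unfolding lorentz_def V1[OF t] V2[OF t] V3 by algebra
    then show ?thesis by (simp add: power_mult_distrib cosh_square_eq algebra_simps)
  qed
  have cont\<phi>: "continuous_on ?I \<phi>" and cont\<theta>: "continuous_on ?I \<theta>"
    using \<phi>' T(2) DERIV_continuous_on by blast+
  \<comment> \<open>Projecting the velocity onto the direction of increasing longitude and dividing
    by \<open>cosh (\<phi> t)\<close> expresses \<open>T t\<close> through continuous
    quantities.\<close>
  have "continuous_on ?I (\<lambda>t. (V t $ 2 * cos (\<theta> t) - V t $ 1 * sin (\<theta> t)) / cosh (\<phi> t))"
    by (intro continuous_intros contV cont\<phi> cont\<theta>) auto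
  moreover have "(V t $ 2 * cos (\<theta> t) - V t $ 1 * sin (\<theta> t)) / cosh (\<phi> t) = T t" if t: "t \<in> ?I" for t
  proof -
    have "V t $ 2 * cos (\<theta> t) - V t $ 1 * sin (\<theta> t) =
        cosh (\<phi> t) * T t * ((sin (\<theta> t))\<^sup>2 + (cos (\<theta> t))\<^sup>2)"
      unfolding V1[OF t] V2[OF t] by algebra
    then show ?thesis by simp
  qed
  ultimately have contT: "continuous_on ?I T"
    by (rule continuous_on_eq)
  have cont\<phi>': "continuous_on ?I \<phi>'"
    unfolding \<phi>'_def by (intro continuous_intros contV cont\<phi>) auto
  have less: "\<bar>\<phi>' t\<bar> < T t * cosh (\<phi> t)" if t: "t \<in> ?I" for t
  proof -
    have "vector_derivative \<Gamma> (at t within ?I) = V t"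
      using vector_derivative_within_closed_interval[OF cd t V[OF t]] .
    then have "(\<phi>' t)\<^sup>2 < (T t * cosh (\<phi> t))\<^sup>2"
      using space[OF t] lor[OF t] by (simp add: Let_def)
    then have "\<bar>\<phi>' t\<bar> < \<bar>T t * cosh (\<phi> t)\<bar>" by (metis abs_le_square_iff not_le)
    with T(1)[OF t] show ?thesis by (simp add: abs_mult)
  qed
  have vd: "lorentz (vector_derivative \<Gamma> (at t)) (vector_derivative \<Gamma> (at t)) =
      (T t * cosh (\<phi> t))\<^sup>2 - (\<phi>' t)\<^sup>2" if "t \<in> {c<..<d}" for t
  proof -
    have "(\<Gamma> has_vector_derivative V t) (at t)"
      using V[of t] that at_within_Icc_at[of c t d] by auto
    then show ?thesis using lor[of t] that by (simp add: vector_derivative_at)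
  qed
  show thesis using that G \<phi>' T(2) cont\<phi>' contT less vd by blast
qed

section \<open>Crossing integrals over disks for arcs and their concatenations\<close>

definition speed :: "(real \<Rightarrow> real^3) \<Rightarrow> real \<Rightarrow> real" where
  "speed \<Gamma> t = sqrt (lorentz (vector_derivative \<Gamma> (at t)) (vector_derivative \<Gamma> (at t)))"

lemma curve_length_eq: "curve_length \<Gamma> c d = integral {c..d} (speed \<Gamma>)"
  by (simp add: curve_length_def speed_def[abs_def])

text \<open>The half-open parameter interval makes the count additive over adjacent arcs.\<close>

definition disk_crossings :: "(real \<Rightarrow> real^3) \<Rightarrow> real \<Rightarrow> real \<Rightarrow> real \<Rightarrow> ennreal" where
  "disk_crossings \<Gamma> c d R =
    (\<integral>\<^sup>+Y. ecard {t \<in> {c..<d}. lorentz (\<Gamma> t) Y = 0} * indicator (hyp_disk R) Y \<partial>hyp_area)"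

text \<open>A form of the Crofton formula that survives joining arcs. Nonnegativity is included
  because \<open>ennreal\<close> truncates at 0 and the right-hand sides have to be added.\<close>

definition crofton_on :: "(real \<Rightarrow> real^3) \<Rightarrow> (real \<Rightarrow> real) \<Rightarrow> real \<Rightarrow> real \<Rightarrow> bool" where
  "crofton_on \<Gamma> \<theta> c d \<longleftrightarrow> c \<le> d \<and> continuous_on {c..d} \<Gamma> \<and> speed \<Gamma> integrable_on {c..d} \<and>
    (\<forall>\<^sub>F R in at_top. 0 \<le> 2 * (\<theta> d - \<theta> c) * cosh R - 2 * curve_length \<Gamma> c d \<and>
      disk_crossings \<Gamma> c d R = ennreal (2 * (\<theta> d - \<theta> c) * cosh R - 2 * curve_length \<Gamma> c d))"

lemma hyp_disk_borel [measurable]: "hyp_disk R \<in> sets borel"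
  unfolding hyp_disk_def hyp_plane_def lorentz_def by measurable

lemma hyp_plane_borel [measurable]: "hyp_plane \<in> sets borel"
  unfolding hyp_plane_def lorentz_def by measurable

lemma disk_crossings_eq:
  assumes "continuous_on {c..d} \<Gamma>"
  shows "disk_crossings \<Gamma> c d R = (\<integral>\<^sup>+u. ennreal (1 / hyp_height u) *
      indicator {u. hyp_height u \<le> cosh R} u * ecard {t \<in> {c..<d}. lorentz (\<Gamma> t) (hyp_chart u) = 0} \<partial>lborel)"
proof -
  have [measurable]: "(\<lambda>Y. ecard {t \<in> {c..<d}. lorentz (\<Gamma> t) Y = 0}) \<in> borel_measurable borel"
    using assms by (rule borel_measurable_ecard_crossings)
  have meas: "(\<lambda>Y. ecard {t \<in> {c..<d}. lorentz (\<Gamma> t) Y = 0} * indicator (hyp_disk R) Y) \<in> borel_measurable borel"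
    by measurable
  show ?thesis
    unfolding disk_crossings_def nn_integral_hyp_area[OF meas]
    by (intro nn_integral_cong) (auto simp: hyp_chart_in_hyp_disk indicator_def)
qed

lemma eventually_cosh_ge: "\<forall>\<^sub>F R in at_top. K \<le> cosh (R :: real)"
  using eventually_ge_at_top[of "2 * K"]
proof eventually_elim
  case (elim R)
  have "2 * K \<le> exp R + exp (- R)" 
    using elim exp_ge_add_one_self[of R] exp_gt_zero[of "- R"] by linarith
  then show ?case by (simp add: cosh_field_def)
qed

text \<open>Compactness bounds the height of the tangent poles over the whole piece by a constant
  \<open>K\<close>, so \<open>crofton_arc\<close> applies as soon as
  \<open>K \<le> cosh R\<close>.\<close>

lemma crofton_on_piece:
  assumes cd: "c < d" and smooth: "smooth_piece c d \<Gamma>"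
    and space: "\<And>t. t \<in> {c..d} \<Longrightarrow> let v = vector_derivative \<Gamma> (at t within {c..d}) in lorentz v v > 0"
    and lon: "\<And>t. t \<in> {c..d} \<Longrightarrow> \<exists>\<phi>. \<Gamma> t = de_sitter_point \<phi> (\<theta> t)"
    and incr: "\<And>t. t \<in> {c..d} \<Longrightarrow> \<exists>D>0. (\<theta> has_real_derivative D) (at t within {c..d})"
    and cont\<Gamma>: "continuous_on {c..d} \<Gamma>"
  shows "crofton_on \<Gamma> \<theta> c d"
proof -
  obtain \<phi> \<phi>' \<theta>' where G: "\<And>t. t \<in> {c..d} \<Longrightarrow> \<Gamma> t = de_sitter_point (\<phi> t) (\<theta> t)"
    and \<phi>': "\<And>t. t \<in> {c..d} \<Longrightarrow> (\<phi> has_real_derivative \<phi>' t) (at t within {c..d})"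
    and \<theta>': "\<And>t. t \<in> {c..d} \<Longrightarrow> (\<theta> has_real_derivative \<theta>' t) (at t within {c..d})"
    and cont': "continuous_on {c..d} \<phi>'" "continuous_on {c..d} \<theta>'"
    and less: "\<And>t. t \<in> {c..d} \<Longrightarrow> \<bar>\<phi>' t\<bar> < \<theta>' t * cosh (\<phi> t)"
    and vd: "\<And>t. t \<in> {c<..<d} \<Longrightarrow> lorentz (vector_derivative \<Gamma> (at t)) (vector_derivative \<Gamma> (at t)) =
      (\<theta>' t * cosh (\<phi> t))\<^sup>2 - (\<phi>' t)\<^sup>2"
    using polar_derivatives_of_piece[OF cd smooth space lon incr] by blast
  have cont: "continuous_on {c..d} \<phi>" "continuous_on {c..d} \<theta>"
    using \<phi>' \<theta>' DERIV_continuous_on by blast+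
  define l where "l t = sqrt ((\<theta>' t * cosh (\<phi> t))\<^sup>2 - (\<phi>' t)\<^sup>2)" for t
  have contl: "continuous_on {c..d} l"
    unfolding l_def by (intro continuous_intros cont cont')
  have lpos: "l t > 0" if "t \<in> {c..d}" for t
    using power_strict_mono[OF less[OF that], of 2] by (simp add: l_def)
  have "(l has_integral integral {c..d} l) {c..d}"
    using contl integrable_continuous_interval by blast
  \<comment> \<open>\<open>speed\<close> uses the two-sided derivative, which is controlled only in
    the interior of the piece; the two endpoints do not affect the integral.\<close>
  then have sp: "(speed \<Gamma> has_integral integral {c..d} l) {c..d}"
    using vd by (subst has_integral_spike_interior_eq[where g = l, unfolded cbox_interval box_real])
      (auto simp: l_def speed_def)
  have len: "curve_length \<Gamma> c d = integral {c..d} l"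
    using sp by (simp add: curve_length_eq integral_unique)
  have "continuous_on {c..d} (\<lambda>t. \<theta>' t * (cosh (\<phi> t))\<^sup>2 / l t)"
    by (intro continuous_intros cont cont' contl) (auto dest: lpos)
  from continuous_attains_sup[OF compact_Icc _ this] cd
  obtain K where K: "\<And>t. t \<in> {c..d} \<Longrightarrow> \<theta>' t * (cosh (\<phi> t))\<^sup>2 / l t \<le> K"
    by (metis atLeastatMost_empty_iff2 less_imp_le)
  \<comment> \<open>The two counts differ only if the left endpoint is itself a crossing, which
    happens for a null set of poles.\<close>
  have half_open: "AE u in lborel. ecard {t \<in> {c..<d}. lorentz (\<Gamma> t) (hyp_chart u) = 0} =
      ecard {t \<in> {c<..<d}. lorentz (de_sitter_point (\<phi> t) (\<theta> t)) (hyp_chart u) = 0}"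
    using AE_lorentz_hyp_chart_nonzero[of "\<phi> c" "\<theta> c"]
  proof eventually_elim
    case (elim u)
    then have "{t \<in> {c..<d}. lorentz (\<Gamma> t) (hyp_chart u) = 0} =
        {t \<in> {c<..<d}. lorentz (de_sitter_point (\<phi> t) (\<theta> t)) (hyp_chart u) = 0}"
      using G cd by (auto simp: less_le)
    then show ?case by (simp only:)
  qed
  have "\<forall>\<^sub>F R in at_top. 0 \<le> 2 * (\<theta> d - \<theta> c) * cosh R - 2 * curve_length \<Gamma> c d \<and>
      disk_crossings \<Gamma> c d R = ennreal (2 * (\<theta> d - \<theta> c) * cosh R - 2 * curve_length \<Gamma> c d)"
    using eventually_cosh_ge[of K]
  proof eventually_elim
    case (elim R)
    have R: "\<theta>' t * (cosh (\<phi> t))\<^sup>2 / sqrt ((\<theta>' t * cosh (\<phi> t))\<^sup>2 - (\<phi>' t)\<^sup>2) \<le> cosh R" if "t \<in> {c..d}" for t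
      using K[OF that] elim by (simp add: l_def)
    have d: "(\<phi> has_real_derivative \<phi>' t) (at t)" "(\<theta> has_real_derivative \<theta>' t) (at t)" if "t \<in> {c<..<d}" for t
      using \<phi>'[of t] \<theta>'[of t] that at_within_Icc_at[of c t d] by auto
    note arc = crofton_arc[OF cd d cont cont' less R]
    have "disk_crossings \<Gamma> c d R = (\<integral>\<^sup>+u. ennreal (1 / hyp_height u) *
        indicator {u. hyp_height u \<le> cosh R} u *
        ecard {t \<in> {c<..<d}. lorentz (de_sitter_point (\<phi> t) (\<theta> t)) (hyp_chart u) = 0} \<partial>lborel)"
      unfolding disk_crossings_eq[OF cont\<Gamma>] using half_open by (intro nn_integral_cong_AE) auto
    then show ?case using arc unfolding len l_def by simp
  qed
  then show ?thesis
    using cd cont\<Gamma> sp by (auto simp: crofton_on_def has_integral_integrable)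
qed

text \<open>Both sides are additive: the longitude differences telescope, the lengths add, and no
  crossing at \<open>b\<close> is counted twice.\<close>

lemma crofton_on_join:
  assumes 1: "crofton_on \<Gamma> \<theta> a b" and 2: "crofton_on \<Gamma> \<theta> b c"
  shows "crofton_on \<Gamma> \<theta> a c"
proof -
  have le: "a \<le> b" "b \<le> c" using 1 2 by (auto simp: crofton_on_def)
  have Un: "{a..c} = {a..b} \<union> {b..c}" using le by auto
  have cont: "continuous_on {a..c} \<Gamma>"
    unfolding Un using 1 2 by (intro continuous_on_closed_Un) (auto simp: crofton_on_def)
  have int: "speed \<Gamma> integrable_on {a..c}"
    using 1 2 by (intro Henstock_Kurzweil_Integration.integrable_combine[OF le]) (auto simp: crofton_on_def)
  have len: "curve_length \<Gamma> a c = curve_length \<Gamma> a b + curve_length \<Gamma> b c"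
    unfolding curve_length_eq using Henstock_Kurzweil_Integration.integral_combine[OF le int] by simp
  have split: "disk_crossings \<Gamma> a c R = disk_crossings \<Gamma> a b R + disk_crossings \<Gamma> b c R" for R
  proof -
    have [measurable]: "(\<lambda>Y. ecard {t \<in> {a..<b}. lorentz (\<Gamma> t) Y = 0}) \<in> borel_measurable borel"
      "(\<lambda>Y. ecard {t \<in> {b..<c}. lorentz (\<Gamma> t) Y = 0}) \<in> borel_measurable borel"
      by (rule borel_measurable_ecard_crossings, use 1 2 in \<open>simp add: crofton_on_def\<close>)+
    have "ecard {t \<in> {a..<c}. lorentz (\<Gamma> t) Y = 0} =
        ecard {t \<in> {a..<b}. lorentz (\<Gamma> t) Y = 0} + ecard {t \<in> {b..<c}. lorentz (\<Gamma> t) Y = 0}" for Y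
    proof -
      have eq: "{t \<in> {a..<c}. lorentz (\<Gamma> t) Y = 0} =
          {t \<in> {a..<b}. lorentz (\<Gamma> t) Y = 0} \<union> {t \<in> {b..<c}. lorentz (\<Gamma> t) Y = 0}"
        using le by auto
      show ?thesis
        unfolding eq by (rule plus_emeasure[symmetric]) auto
    qed
    then show ?thesis
      unfolding disk_crossings_def by (simp only: distrib_right) (rule nn_integral_add; measurable)
  qed
  have "\<forall>\<^sub>F R in at_top. 0 \<le> 2 * (\<theta> c - \<theta> a) * cosh R - 2 * curve_length \<Gamma> a c \<and>
      disk_crossings \<Gamma> a c R = ennreal (2 * (\<theta> c - \<theta> a) * cosh R - 2 * curve_length \<Gamma> a c)"
    using 1[unfolded crofton_on_def, THEN conjunct2, THEN conjunct2, THEN conjunct2]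
      2[unfolded crofton_on_def, THEN conjunct2, THEN conjunct2, THEN conjunct2]
  proof eventually_elim
    case (elim R)
    have eq: "2 * (\<theta> c - \<theta> a) * cosh R - 2 * curve_length \<Gamma> a c =
        (2 * (\<theta> b - \<theta> a) * cosh R - 2 * curve_length \<Gamma> a b) +
        (2 * (\<theta> c - \<theta> b) * cosh R - 2 * curve_length \<Gamma> b c)"
      unfolding len by (simp add: algebra_simps)
    show ?case
      unfolding eq split using elim by (simp add: ennreal_plus)
  qed
  then show ?thesis
    using le cont int by (simp add: crofton_on_def)
qed

section \<open>The area of the hyperbolic disk\<close>

text \<open>All tangent poles of the equator coincide with the apex, so \<open>crofton_arc\<close>
  holds for every \<open>R\<close> and yields \<open>4 * pi * cosh R - 4 * pi\<close>. As almost
  every count is 2, this is twice the area.\<close>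

lemma emeasure_hyp_disk: "emeasure hyp_area (hyp_disk R) = ennreal (2 * pi * (cosh R - 1))"
proof -
  let ?n = "\<lambda>u. ecard {t \<in> {0<..<2 * pi}. lorentz (de_sitter_point 0 t) (hyp_chart u) = 0}"
  have n: "AE u in lborel. ?n u = 2"
    using AE_lorentz_hyp_chart_nonzero[of 0 0]
  proof eventually_elim
    case (elim u)
    then have u1: "u$1 \<noteq> 0" by (simp add: lorentz_def de_sitter_point_def)
    \<comment> \<open>The direction, between \<open>- pi / 2\<close> and \<open>pi / 2\<close>, of
      the line through the origin and \<open>u\<close>. With this choice the zeros
      \<open>\<alpha> + pi / 2\<close> and \<open>\<alpha> + 3 * (pi / 2)\<close> both lie between
      \<open>0\<close> and \<open>2 * pi\<close>.\<close>
    define \<alpha> where "\<alpha> = arctan (u$2 / u$1)"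
    have "- (pi / 2) < \<alpha>" "\<alpha> < pi / 2"
      by (simp_all only: \<alpha>_def arctan_lbound arctan_ubound)
    then have \<alpha>: "- (pi / 2) < \<alpha>" "\<alpha> < pi / 2" "cos \<alpha> > 0"
      by (auto intro: cos_gt_zero_pi)
    have "tan \<alpha> = u$2 / u$1" by (simp add: \<alpha>_def tan_arctan)
    then have u2: "u$2 * cos \<alpha> = u$1 * sin \<alpha>"
      using \<alpha>(3) u1 by (simp add: tan_def field_simps)
    have zero: "lorentz (de_sitter_point 0 t) (hyp_chart u) = 0 \<longleftrightarrow> cos (t - \<alpha>) = 0" for t
    proof -
      have "cos \<alpha> * lorentz (de_sitter_point 0 t) (hyp_chart u) = u$1 * cos (t - \<alpha>)"
        using u2 unfolding cos_diff lorentz_def de_sitter_point_def by simp algebra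
      then show ?thesis using u1 \<alpha>(3) by (metis less_irrefl mult_eq_0_iff)
    qed
    have "{t \<in> {0<..<2 * pi}. lorentz (de_sitter_point 0 t) (hyp_chart u) = 0} =
        {\<alpha> + pi / 2, \<alpha> + 3 * (pi / 2)}"
    proof (intro equalityI subsetI)
      fix t assume "t \<in> {t \<in> {0<..<2 * pi}. lorentz (de_sitter_point 0 t) (hyp_chart u) = 0}"
      then have t: "0 < t" "t < 2 * pi" "cos (t - \<alpha>) = 0" by (auto simp: zero)
      then obtain i where i: "odd i" "t - \<alpha> = of_int i * (pi / 2)" by (auto simp: cos_zero_iff_int)
      \<comment> \<open>The bounds on \<open>t\<close> and \<open>\<alpha>\<close> leave
        \<open>-1 < i < 5\<close>, and oddness then leaves 1 and 3.\<close>
      have "of_int i * (pi / 2) > (-1) * (pi / 2)" "of_int i * (pi / 2) < 5 * (pi / 2)"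
        using t \<alpha> i(2) by linarith+
      then have "(-1::real) < of_int i" "of_int i < (5::real)"
        by (simp_all only: mult_less_cancel_right_pos pi_half_gt_zero)
      then have "i \<in> {0,1,2,3,4}" by auto
      with i show "t \<in> {\<alpha> + pi / 2, \<alpha> + 3 * (pi / 2)}" by auto
    next
      fix t assume "t \<in> {\<alpha> + pi / 2, \<alpha> + 3 * (pi / 2)}"
      moreover have "cos (3 * (pi / 2)) = 0" using cos_zero_iff_int[of "3 * (pi / 2)"] by (auto intro!: exI[of _ 3])
      ultimately show "t \<in> {t \<in> {0<..<2 * pi}. lorentz (de_sitter_point 0 t) (hyp_chart u) = 0}"
        using \<alpha> by (auto simp: zero)
    qed
    then show ?case by (simp only:) simp
  qed
  have "2 * emeasure hyp_area (hyp_disk R) = (\<integral>\<^sup>+Y. 2 * indicator (hyp_disk R) Y \<partial>hyp_area)"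
    by (simp add: nn_integral_cmult)
  also have "\<dots> = (\<integral>\<^sup>+u. ennreal (1 / hyp_height u) * indicator {u. hyp_height u \<le> cosh R} u * ?n u \<partial>lborel)"
    using n by (subst nn_integral_hyp_area)
      (auto intro!: nn_integral_cong_AE simp: hyp_chart_in_hyp_disk indicator_def mult.commute elim!: eventually_mono)
  also have "\<dots> = ennreal (2 * (2 * pi - 0) * cosh R - 2 * integral {0..2 * pi} (\<lambda>t. sqrt ((1 * cosh 0)\<^sup>2 - 0\<^sup>2)))"
    by (rule crofton_arc(2)) (auto intro!: derivative_eq_intros continuous_intros simp: cosh_real_ge_1)
  also have "\<dots> = ennreal (2 * (2 * pi * (cosh R - 1)))"
    by (simp add: algebra_simps)
  also have "\<dots> = 2 * ennreal (2 * pi * (cosh R - 1))"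
    using cosh_real_ge_1[of R] by (subst ennreal_mult) auto
  finally show ?thesis by (simp add: ennreal_mult_cancel_left)
qed

subsection \<open>Crossings far from the apex\<close>

text \<open>Two longitudes of the same point differ by a multiple of \<open>2 * pi\<close>, and a
  continuous function on an interval with such discrete values is constant. This carries the index
  over to the longitude that is known to be increasing.\<close>

lemma longitude_change_unique:
  assumes "a \<le> b" and 1: "longitude_along \<Gamma> a b \<theta>\<^sub>1" and 2: "longitude_along \<Gamma> a b \<theta>\<^sub>2"
  shows "\<theta>\<^sub>1 b - \<theta>\<^sub>1 a = \<theta>\<^sub>2 b - \<theta>\<^sub>2 a"
proof -
  let ?d = "\<lambda>t. \<theta>\<^sub>1 t - \<theta>\<^sub>2 t"
  have mult: "\<exists>n::int. ?d t = 2 * pi * of_int n" if t: "t \<in> {a..b}" for t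
  proof -
    obtain \<phi>\<^sub>1 where "\<Gamma> t = de_sitter_point \<phi>\<^sub>1 (\<theta>\<^sub>1 t)"
      using 1[unfolded longitude_along_def, THEN conjunct2] t by blast
    moreover obtain \<phi>\<^sub>2 where "\<Gamma> t = de_sitter_point \<phi>\<^sub>2 (\<theta>\<^sub>2 t)"
      using 2[unfolded longitude_along_def, THEN conjunct2] t by blast
    ultimately have "de_sitter_point \<phi>\<^sub>1 (\<theta>\<^sub>1 t) = de_sitter_point \<phi>\<^sub>2 (\<theta>\<^sub>2 t)" by simp
    then have eq: "sinh \<phi>\<^sub>1 = sinh \<phi>\<^sub>2" "cosh \<phi>\<^sub>1 * cos (\<theta>\<^sub>1 t) = cosh \<phi>\<^sub>2 * cos (\<theta>\<^sub>2 t)"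
        "cosh \<phi>\<^sub>1 * sin (\<theta>\<^sub>1 t) = cosh \<phi>\<^sub>2 * sin (\<theta>\<^sub>2 t)"
      by (auto simp: de_sitter_point_def vec_eq_iff forall_3)
    from eq(1) have "\<phi>\<^sub>1 = \<phi>\<^sub>2" by simp
    with eq have "sin (\<theta>\<^sub>1 t) = sin (\<theta>\<^sub>2 t) \<and> cos (\<theta>\<^sub>1 t) = cos (\<theta>\<^sub>2 t)" by simp
    then obtain n :: int where "\<theta>\<^sub>1 t = \<theta>\<^sub>2 t + 2 * pi * of_int n"
      using sin_cos_eq_iff by metis
    then show ?thesis by auto
  qed
  have "?d constant_on {a..b}"
  proof (rule continuous_discrete_range_constant)
    show "continuous_on {a..b} ?d"
      using 1 2 by (auto simp: longitude_along_def intro!: continuous_intros)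
    fix s assume s: "s \<in> {a..b}"
    have "2 * pi \<le> norm (?d t - ?d s)" if t: "t \<in> {a..b}" "?d t \<noteq> ?d s" for t
    proof -
      obtain k n :: int where kn: "?d s = 2 * pi * of_int k" "?d t = 2 * pi * of_int n"
        using mult[OF s] mult[OF t(1)] by blast
      have "n \<noteq> k" using kn t(2) by auto
      then have "1 \<le> \<bar>n - k\<bar>" by simp
      then have "1 \<le> \<bar>of_int n - (of_int k :: real)\<bar>" by linarith
      moreover have "norm (?d t - ?d s) = 2 * pi * \<bar>of_int n - of_int k\<bar>"
        unfolding kn by (simp add: abs_mult flip: right_diff_distrib)
      ultimately show ?thesis by simp
    qed
    then show "\<exists>e>0. \<forall>t. t \<in> {a..b} \<and> ?d t \<noteq> ?d s \<longrightarrow> e \<le> norm (?d t - ?d s)"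
      by (intro exI[of _ "2 * pi"]) auto
  qed simp
  then have "?d a = ?d b"
    using \<open>a \<le> b\<close> unfolding constant_on_def by (metis atLeastAtMost_iff order_refl)
  then show ?thesis by linarith
qed

lemma IVT_alternating:
  fixes g :: "real \<Rightarrow> real"
  assumes "s < t" "continuous_on {s..t} g" "g s * g t < 0"
  shows "\<exists>x. s < x \<and> x < t \<and> g x = 0"
proof -
  have "\<exists>x. s \<le> x \<and> x \<le> t \<and> g x = 0"
  proof (cases "g s < 0")
    case True
    with assms have "0 \<le> g t" by (auto simp: mult_less_0_iff)
    with True show ?thesis using IVT'[of g s 0 t] assms by auto
  next
    case False
    with assms have "g t \<le> 0" "0 \<le> g s" by (auto simp: mult_less_0_iff)
    then show ?thesis using IVT2'[of g t 0 s] assms by auto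
  qed
  then obtain x where x: "s \<le> x" "x \<le> t" "g x = 0" by blast
  moreover have "x \<noteq> s" "x \<noteq> t" using x(3) assms(3) by auto
  ultimately show ?thesis by (intro exI[of _ x]) auto
qed

text \<open>Between consecutive sample points there is a zero, and the sample points being even in number,
  one more lies on the arc of the closed curve through the base point.\<close>

lemma ecard_zeros_ge_alternating:
  fixes g :: "real \<Rightarrow> real" and \<tau> :: "nat \<Rightarrow> real"
  assumes g: "continuous_on {a..b} g" "g a = g b" and n: "n > 0"
    and \<tau>: "\<And>k. k < 2 * n \<Longrightarrow> a \<le> \<tau> k \<and> \<tau> k < b"
    and mono: "\<And>k. Suc k < 2 * n \<Longrightarrow> \<tau> k < \<tau> (Suc k)"
    and alt: "\<And>k. Suc k < 2 * n \<Longrightarrow> g (\<tau> k) * g (\<tau> (Suc k)) < 0"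
    and ends: "g (\<tau> 0) * g (\<tau> (2 * n - 1)) < 0"
  shows "of_nat (2 * n) \<le> ecard {t \<in> {a..<b}. g t = 0}"
proof (cases "finite {t \<in> {a..<b}. g t = 0}")
  case True
  let ?Z = "{t \<in> {a..<b}. g t = 0}" and ?m = "2 * n - 1"
  have le: "\<tau> i \<le> \<tau> j" if "i \<le> j" "j < 2 * n" for i j
    using that
  proof (induction j rule: dec_induct)
    case (step j)
    then show ?case using mono[of j] by simp
  qed simp
  have sub: "continuous_on {s..t} g" if "a \<le> s" "t \<le> b" for s t
    using g(1) by (rule continuous_on_subset) (use that in auto)
  have "\<exists>z. \<tau> k < z \<and> z < \<tau> (Suc k) \<and> g z = 0" if "k < ?m" for k
  proof (intro IVT_alternating mono alt sub)
    show "Suc k < 2 * n" using that by simp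
    then show "a \<le> \<tau> k" "\<tau> (Suc k) \<le> b" using \<tau>[of k] \<tau>[of "Suc k"] by auto
  qed (use that in simp)+
  then obtain z where z: "\<And>k. k < ?m \<Longrightarrow> \<tau> k < z k \<and> z k < \<tau> (Suc k) \<and> g (z k) = 0"
    by metis
  have z_less: "z i < z j" if "i < j" "j < ?m" for i j
  proof -
    have "z i < \<tau> (Suc i)" "\<tau> j < z j" using z that by auto
    moreover have "\<tau> (Suc i) \<le> \<tau> j" using that by (intro le) auto
    ultimately show ?thesis by linarith
  qed
  then have "strict_mono_on {..<?m} z" by (auto intro: strict_mono_onI)
  then have inj: "inj_on z {..<?m}" by (rule strict_mono_on_imp_inj_on)
  have zZ: "z ` {..<?m} \<subseteq> ?Z"
  proof
    fix x assume "x \<in> z ` {..<?m}"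
    then obtain k where k: "k < ?m" "x = z k" by auto
    then have "Suc k < 2 * n" by simp
    then show "x \<in> ?Z" using k z[of k] \<tau>[of k] \<tau>[of "Suc k"] by auto
  qed
  have \<tau>0: "a \<le> \<tau> 0" "\<tau> 0 < b" and \<tau>m: "a \<le> \<tau> ?m" "\<tau> ?m < b" using \<tau> n by auto
  have "\<exists>x\<in>?Z. x < \<tau> 0 \<or> \<tau> ?m < x"
  proof -
    \<comment> \<open>The first and the last sample value have opposite signs, so the common value
      of \<open>g\<close> at the two ends, unless it is 0, opposes one of them. This supplies a zero
      outside the span of the samples.\<close>
    have "g a = 0 \<or> g a * g (\<tau> 0) < 0 \<or> g (\<tau> ?m) * g b < 0"
      using ends g(2) unfolding mult_less_0_iff by linarith
    then consider "g a = 0" | "g a * g (\<tau> 0) < 0" | "g (\<tau> ?m) * g b < 0" by blast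
    then show ?thesis
    proof cases
      case 1
      then have "a \<noteq> \<tau> 0" using ends by auto
      then show ?thesis using 1 \<tau>0 by (intro bexI[of _ a]) auto
    next
      case 2
      then have "a \<noteq> \<tau> 0" by (auto simp: mult_less_0_iff)
      then have "\<exists>x. a < x \<and> x < \<tau> 0 \<and> g x = 0"
        using 2 \<tau>0 by (intro IVT_alternating sub) auto
      then obtain x where "a < x" "x < \<tau> 0" "g x = 0" by blast
      then show ?thesis using \<tau>0(2) by (intro bexI[of _ x]) auto
    next
      case 3
      then have "\<exists>x. \<tau> ?m < x \<and> x < b \<and> g x = 0"
        using 3 \<tau>m by (intro IVT_alternating sub) auto
      then obtain x where "\<tau> ?m < x" "x < b" "g x = 0" by blast
      then show ?thesis using \<tau>m(1) by (intro bexI[of _ x]) auto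
    qed
  qed
  then obtain x where x: "x \<in> ?Z" "x < \<tau> 0 \<or> \<tau> ?m < x" by blast
  have "x \<noteq> z k" if "k < ?m" for k
  proof -
    have "\<tau> 0 \<le> \<tau> k" "\<tau> (Suc k) \<le> \<tau> ?m" using that by (auto intro: le)
    then show ?thesis using z[OF that] x(2) by auto
  qed
  then have "x \<notin> z ` {..<?m}" by auto
  then have "card (insert x (z ` {..<?m})) = 2 * n"
    using inj n by (simp add: card_image)
  moreover have "card (insert x (z ` {..<?m})) \<le> card ?Z"
    using True x(1) zZ by (intro card_mono) auto
  ultimately have "2 * n \<le> card ?Z" by simp
  then show ?thesis
    using True by (simp only: emeasure_count_space_finite[OF subset_UNIV] of_nat_le_iff)
next
  case False
  then have "ecard {t \<in> {a..<b}. g t = 0} = \<infinity>"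
    by (rule emeasure_count_space_infinite[OF subset_UNIV])
  then show ?thesis by (simp only: infinity_ennreal_def top_greatest)
qed

text \<open>At a point whose height exceeds \<open>cosh (\<phi> t)\<close> along the whole curve,
  the term with \<open>cos (\<theta> t - \<alpha>0)\<close> outweighs the term with
  \<open>sinh (\<phi> t)\<close> wherever that cosine is \<open>1\<close> or \<open>-1\<close>. Such
  longitudes are spaced by \<open>pi\<close>, so \<open>n\<close> turns contain \<open>2 * n\<close>
  of them, with alternating signs of the product.\<close>

lemma ecard_crossings_ge:
  fixes \<Gamma> :: "real \<Rightarrow> real^3"
  assumes ab: "a < b" and cont\<Gamma>: "continuous_on {a..b} \<Gamma>" and closed: "\<Gamma> a = \<Gamma> b"
    and cont\<theta>: "continuous_on {a..b} \<theta>"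
    and \<Gamma>: "\<And>t. t \<in> {a..b} \<Longrightarrow> \<Gamma> t = de_sitter_point (\<phi> t) (\<theta> t)"
    and mono: "strict_mono_on {a..b} \<theta>" and total: "\<theta> b - \<theta> a = 2 * real n * pi"
    and far: "\<And>t. t \<in> {a..b} \<Longrightarrow> cosh (\<phi> t) < hyp_height u"
  shows "of_nat (2 * n) \<le> ecard {t \<in> {a..<b}. lorentz (\<Gamma> t) (hyp_chart u) = 0}"
proof -
  let ?g = "\<lambda>t. lorentz (\<Gamma> t) (hyp_chart u)"
  have n: "n > 0"
    using total strict_mono_onD[OF mono, of a b] ab by (cases n) auto
  define z where "z = Complex (u$1) (u$2)"
  obtain \<rho> \<alpha>0 where "z = rcis \<rho> \<alpha>0" by (metis rcis_cmod_Arg)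
  then have "u$1 = \<rho> * cos \<alpha>0" "u$2 = \<rho> * sin \<alpha>0"
    by (simp_all add: z_def complex_eq_iff)
  note u0 = this
  \<comment> \<open>\<open>N\<close> shifts \<open>\<alpha>0\<close> to the first such longitude
    that is at least \<open>\<theta> a\<close>; the following ones up to index
    \<open>2 * n - 1\<close> stay below \<open>\<theta> b\<close>.\<close>
  define N where "N = \<lceil>(\<theta> a - \<alpha>0) / pi\<rceil>"
  define \<alpha> where "\<alpha> = \<alpha>0 + of_int N * pi"
  have \<alpha>: "\<theta> a \<le> \<alpha>" "\<alpha> < \<theta> a + pi"
  proof -
    have "(\<theta> a - \<alpha>0) / pi \<le> of_int N" "of_int N < (\<theta> a - \<alpha>0) / pi + 1"
      unfolding N_def by linarith+
    then show "\<theta> a \<le> \<alpha>" "\<alpha> < \<theta> a + pi"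
      by (simp_all add: \<alpha>_def field_simps)
  qed
  have g_eq: "?g t = cosh (\<phi> t) * (\<rho> * cos (\<theta> t - \<alpha>0)) - sinh (\<phi> t) * hyp_height u" if "t \<in> {a..b}" for t
    by (simp add: \<Gamma>[OF that] lorentz_def de_sitter_point_def u0 cos_diff algebra_simps)
  have \<rho>: "\<rho>\<^sup>2 = (hyp_height u)\<^sup>2 - 1"
  proof -
    have "(hyp_height u)\<^sup>2 = 1 + \<rho>\<^sup>2 * ((sin \<alpha>0)\<^sup>2 + (cos \<alpha>0)\<^sup>2)"
      unfolding hyp_height(3) u0 by algebra
    then show ?thesis by simp
  qed
  \<comment> \<open>After squaring and inserting \<open>\<rho>\<close>, this amounts to
    \<open>cosh (\<phi> t) < hyp_height u\<close>.\<close>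
  have big: "\<bar>sinh (\<phi> t) * hyp_height u\<bar> < \<bar>cosh (\<phi> t) * \<rho>\<bar>" if "t \<in> {a..b}" for t
  proof -
    have "(cosh (\<phi> t))\<^sup>2 < (hyp_height u)\<^sup>2"
      using far[OF that] by (intro power_strict_mono) auto
    then have "(sinh (\<phi> t) * hyp_height u)\<^sup>2 < (cosh (\<phi> t) * \<rho>)\<^sup>2"
      unfolding power_mult_distrib \<rho> by (simp add: cosh_square_eq algebra_simps)
    then show ?thesis by (metis abs_le_square_iff not_le)
  qed
  \<comment> \<open>The value of the cosine at the sample of index \<open>k\<close>. It alternates
    between \<open>1\<close> and \<open>-1\<close>, so over an even number of samples the first and
    the last are opposite.\<close>
  define e where "e k = cos (of_int N * pi + real k * pi)" for k
  have e_sq: "(e k)\<^sup>2 = 1" for k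
  proof -
    have "sin (of_int N * pi + real k * pi) = sin (of_int (N + int k) * pi)"
      by (simp add: distrib_right)
    also have "\<dots> = 0" by (simp only: sin_times_pi_eq_0 Ints_of_int)
    finally show ?thesis
      using sin_cos_squared_add[of "of_int N * pi + real k * pi"] by (simp add: e_def)
  qed
  have e_Suc: "e (Suc k) = - e k" for k
    using cos_periodic_pi[of "of_int N * pi + real k * pi"] by (simp add: e_def algebra_simps)
  have e_even: "e (2 * k) = e 0" for k
    by (induction k) (simp_all add: e_Suc)
  have "e (2 * n) = - e (2 * n - 1)"
    using e_Suc[of "2 * n - 1"] n by simp
  then have e_last: "e (2 * n - 1) = - e 0" using e_even[of n] by simp
  have "\<exists>t\<in>{a..<b}. \<theta> t = \<alpha> + real k * pi" if "k < 2 * n" for k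
  proof -
    have "real k + 1 \<le> 2 * real n" using that by linarith
    then have "real k * pi + pi \<le> 2 * real n * pi"
      by (metis distrib_right mult_1 mult_right_mono pi_ge_zero)
    then have up: "\<alpha> + real k * pi < \<theta> b" using \<alpha> total by linarith
    moreover have "\<theta> a \<le> \<alpha> + real k * pi" using \<alpha> by (simp add: add_increasing2)
    ultimately obtain t where "a \<le> t" "t \<le> b" "\<theta> t = \<alpha> + real k * pi"
      using IVT'[of \<theta> a "\<alpha> + real k * pi" b] ab cont\<theta> by auto
    then show ?thesis using up by (intro bexI[of _ t]) (auto simp: less_le)
  qed
  then obtain \<tau> where \<tau>: "\<And>k. k < 2 * n \<Longrightarrow> \<tau> k \<in> {a..<b} \<and> \<theta> (\<tau> k) = \<alpha> + real k * pi"
    by metis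
  \<comment> \<open>Multiplying by \<open>\<rho> * e k\<close> tests the sign of \<open>?g\<close>
    whichever sign \<open>\<rho>\<close> has.\<close>
  have pos: "0 < ?g (\<tau> k) * (\<rho> * e k)" if "k < 2 * n" for k
  proof -
    have t: "\<tau> k \<in> {a..b}" using \<tau>[OF that] by auto
    let ?c = "cosh (\<phi> (\<tau> k)) * \<rho>" and ?s = "sinh (\<phi> (\<tau> k)) * hyp_height u"
    have "\<rho> \<noteq> 0" using big[OF t] by auto
    then have "\<bar>?s * (\<rho> * e k)\<bar> < \<bar>?c * \<rho>\<bar>"
      using big[OF t] e_sq[of k] by (simp add: abs_mult abs_square_eq_1 mult.commute)
    moreover have "\<bar>?c * \<rho>\<bar> = ?c * \<rho>" by (simp add: mult.assoc)
    moreover have "?g (\<tau> k) * (\<rho> * e k) = ?c * \<rho> * (e k)\<^sup>2 - ?s * (\<rho> * e k)"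
    proof -
      have "cos (\<theta> (\<tau> k) - \<alpha>0) = e k"
        using \<tau>[OF that] by (simp add: \<alpha>_def e_def)
      then show ?thesis
        unfolding g_eq[OF t] by (simp add: power2_eq_square algebra_simps)
    qed
    ultimately show ?thesis unfolding e_sq by linarith
  qed
  have neg: "?g (\<tau> i) * ?g (\<tau> j) < 0" if "i < 2 * n" "j < 2 * n" "e i = - e j" for i j
  proof -
    have "0 < (?g (\<tau> i) * (\<rho> * e i)) * (?g (\<tau> j) * (\<rho> * e j))"
      by (rule mult_pos_pos[OF pos[OF that(1)] pos[OF that(2)]])
    also have "\<dots> = - (\<rho>\<^sup>2 * (e j)\<^sup>2) * (?g (\<tau> i) * ?g (\<tau> j))"
      unfolding that(3) by (simp add: power2_eq_square algebra_simps)
    also have "\<dots> = - (\<rho>\<^sup>2 * (?g (\<tau> i) * ?g (\<tau> j)))"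
      by (simp add: e_sq)
    finally have "\<rho>\<^sup>2 * (?g (\<tau> i) * ?g (\<tau> j)) < 0" by simp
    then show ?thesis by (simp only: mult_less_0_iff[of "\<rho>\<^sup>2"]) (metis not_less zero_le_power2)
  qed
  show ?thesis
  proof (rule ecard_zeros_ge_alternating[where g = ?g and \<tau> = \<tau>])
    show "continuous_on {a..b} ?g"
      unfolding lorentz_def by (intro continuous_intros cont\<Gamma>)
    show "?g a = ?g b" using closed by simp
    show "a \<le> \<tau> k \<and> \<tau> k < b" if "k < 2 * n" for k using \<tau>[OF that] by auto
    show "\<tau> k < \<tau> (Suc k)" if "Suc k < 2 * n" for k
    proof (rule ccontr)
      assume "\<not> \<tau> k < \<tau> (Suc k)"
      then have "\<theta> (\<tau> (Suc k)) \<le> \<theta> (\<tau> k)"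
        using strict_mono_onD[OF mono, of "\<tau> (Suc k)" "\<tau> k"] \<tau>[of k] \<tau>[of "Suc k"] that
        by (cases "\<tau> (Suc k) = \<tau> k") auto
      then show False using \<tau>[of k] \<tau>[of "Suc k"] that pi_gt_zero by (simp add: distrib_right)
    qed
    show "?g (\<tau> k) * ?g (\<tau> (Suc k)) < 0" if "Suc k < 2 * n" for k
      using that by (intro neg) (auto simp: e_Suc)
    show "?g (\<tau> 0) * ?g (\<tau> (2 * n - 1)) < 0"
      using n e_last by (intro neg) auto
  qed (fact n)
qed

subsection \<open>Closed curves\<close>

lemma subdivision_mono:
  assumes "subdivision m p a b" "i \<le> j" "j \<le> m"
  shows "p i \<le> p j"
  using assms(2,3)
proof (induction j rule: dec_induct)
  case (step j)
  then have "p j < p (Suc j)" using assms(1) by (auto simp: subdivision_def)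
  with step show ?case by simp
qed simp

lemma subdivision_induct:
  assumes sub: "subdivision m p a b"
    and piece: "\<And>i. i < m \<Longrightarrow> P (p i) (p (Suc i))"
    and join: "\<And>c d e. c \<le> d \<Longrightarrow> d \<le> e \<Longrightarrow> P c d \<Longrightarrow> P d e \<Longrightarrow> P c e"
  shows "P a b"
proof -
  have "P (p 0) (p k)" if "0 < k" "k \<le> m" for k
    using that
  proof (induction k rule: nat_induct_non_zero)
    case 1
    then show ?case using piece[of 0] by simp
  next
    case (Suc k)
    then show ?case
      using piece[of k] join[of "p 0" "p k" "p (Suc k)"] subdivision_mono[OF sub] by simp
  qed
  then show ?thesis using sub by (auto simp: subdivision_def)
qed

text \<open>Within a piece the derivative is two-sided in the interior, and continuity covers the
  ends; two parameters separated by a breakpoint are compared through it.\<close>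

lemma strict_mono_on_longitude:
  assumes sub: "subdivision m p a b" and incr: "longitude_increasing m p \<theta>"
  shows "strict_mono_on {a..b} \<theta>"
proof (rule subdivision_induct[OF sub])
  fix i assume i: "i < m"
  let ?I = "{p i..p (Suc i)}"
  have D: "\<exists>D>0. (\<theta> has_real_derivative D) (at t within ?I)" if "t \<in> ?I" for t
    using incr i that by (auto simp: longitude_increasing_def)
  then have cont: "continuous_on ?I \<theta>"
    by (meson continuous_on_eq_continuous_within has_real_derivative_iff_has_vector_derivative
        has_vector_derivative_continuous)
  show "strict_mono_on ?I \<theta>"
  proof (rule strict_mono_onI)
    fix r s assume rs: "r \<in> ?I" "s \<in> ?I" "r < s"
    show "\<theta> r < \<theta> s"
    proof (rule DERIV_pos_imp_increasing_open[OF \<open>r < s\<close>])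
      fix t assume "r < t" "t < s"
      then have "p i < t" "t < p (Suc i)" using rs by auto
      then show "\<exists>y. (\<theta> has_real_derivative y) (at t) \<and> 0 < y"
        using D[of t] at_within_Icc_at[of "p i" t "p (Suc i)"] by auto
    next
      show "continuous_on {r..s} \<theta>"
        using cont by (rule continuous_on_subset) (use rs in auto)
    qed
  qed
next
  fix c d e :: real assume "c \<le> d" "d \<le> e"
    and 1: "strict_mono_on {c..d} \<theta>" and 2: "strict_mono_on {d..e} \<theta>"
  show "strict_mono_on {c..e} \<theta>"
  proof (rule strict_mono_onI)
    fix r s assume rs: "r \<in> {c..e}" "s \<in> {c..e}" "r < s"
    consider "s \<le> d" | "d \<le> r" | "r < d" "d < s" by linarith
    then show "\<theta> r < \<theta> s"
    proof cases
      case 3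
      then have "\<theta> r < \<theta> d" "\<theta> d < \<theta> s"
        using rs by (auto intro: strict_mono_onD[OF 1] strict_mono_onD[OF 2])
      then show ?thesis by simp
    qed (use rs in \<open>auto intro: strict_mono_onD[OF 1] strict_mono_onD[OF 2]\<close>)
  qed
qed

lemma crofton_on_closed_curve:
  assumes cps: "closed_piecewise_smooth m p a b \<Gamma>" and space: "spacelike_curve m p \<Gamma>"
    and lon: "longitude_along \<Gamma> a b \<theta>" and incr: "longitude_increasing m p \<theta>"
  shows "crofton_on \<Gamma> \<theta> a b"
proof -
  have sub: "subdivision m p a b" using cps by (simp add: closed_piecewise_smooth_def)
  then have ends: "p 0 = a" "p m = b" by (auto simp: subdivision_def)
  show ?thesis
  proof (rule subdivision_induct[OF sub])
    fix i assume i: "i < m"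
    have I: "{p i..p (Suc i)} \<subseteq> {a..b}"
      using subdivision_mono[OF sub, of 0 i] subdivision_mono[OF sub, of "Suc i" m] i ends by auto
    show "crofton_on \<Gamma> \<theta> (p i) (p (Suc i))"
    proof (rule crofton_on_piece)
      show "p i < p (Suc i)" using sub i by (simp add: subdivision_def)
      show "smooth_piece (p i) (p (Suc i)) \<Gamma>" using cps i by (simp add: closed_piecewise_smooth_def)
      show "continuous_on {p i..p (Suc i)} \<Gamma>"
        using cps I by (auto simp: closed_piecewise_smooth_def intro: continuous_on_subset)
      fix t assume t: "t \<in> {p i..p (Suc i)}"
      show "let v = vector_derivative \<Gamma> (at t within {p i..p (Suc i)}) in lorentz v v > 0"
        using space i t unfolding spacelike_curve_def by blast
      show "\<exists>\<phi>. \<Gamma> t = de_sitter_point \<phi> (\<theta> t)"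
        using lon[unfolded longitude_along_def, THEN conjunct2] t I by blast
      show "\<exists>D>0. (\<theta> has_real_derivative D) (at t within {p i..p (Suc i)})"
        using incr i t unfolding longitude_increasing_def by blast
    qed
  qed (rule crofton_on_join)
qed

text \<open>\<open>cosh (\<phi> t)\<close> is bounded along the curve by compactness, so every point
  outside a large disk meets the height condition of \<open>ecard_crossings_ge\<close>.\<close>

lemma eventually_ecard_crossings_ge:
  assumes cps: "closed_piecewise_smooth m p a b \<Gamma>"
    and lon: "longitude_along \<Gamma> a b \<theta>" and incr: "longitude_increasing m p \<theta>"
    and total: "\<theta> b - \<theta> a = 2 * real n * pi"
  shows "\<forall>\<^sub>F R in at_top. \<forall>Y\<in>hyp_plane - hyp_disk R.
    of_nat (2 * n) \<le> ecard {t \<in> {a..<b}. lorentz (\<Gamma> t) Y = 0}"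
proof -
  have sub: "subdivision m p a b" and cont\<Gamma>: "continuous_on {a..b} \<Gamma>" and closed: "\<Gamma> a = \<Gamma> b"
    using cps by (simp_all add: closed_piecewise_smooth_def)
  have ab: "a < b"
    using subdivision_mono[OF sub, of 1 m] sub by (auto simp: subdivision_def)
  define \<phi> where "\<phi> t = arsinh (\<Gamma> t $ 3)" for t
  have \<Gamma>: "\<Gamma> t = de_sitter_point (\<phi> t) (\<theta> t)" if t: "t \<in> {a..b}" for t
  proof -
    obtain \<phi>0 where "\<Gamma> t = de_sitter_point \<phi>0 (\<theta> t)"
      using lon[unfolded longitude_along_def, THEN conjunct2] t by blast
    then show ?thesis by (simp add: \<phi>_def de_sitter_point_def arsinh_sinh_real)
  qed
  have "continuous_on {a..b} (\<lambda>t. cosh (\<phi> t))"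
    unfolding \<phi>_def by (intro continuous_intros cont\<Gamma>)
  from continuous_attains_sup[OF compact_Icc _ this] ab
  obtain K where K: "\<And>t. t \<in> {a..b} \<Longrightarrow> cosh (\<phi> t) \<le> K"
    by (metis atLeastatMost_empty_iff2 less_imp_le)
  show ?thesis
    using eventually_cosh_ge[of K]
  proof eventually_elim
    case (elim R)
    show ?case
    proof
      fix Y assume Y: "Y \<in> hyp_plane - hyp_disk R"
      then obtain u where u: "Y = hyp_chart u"
        using bij_betw_hyp_chart by (auto simp: bij_betw_def)
      with Y have "cosh R < hyp_height u" by (simp add: hyp_chart_in_hyp_disk)
      then show "of_nat (2 * n) \<le> ecard {t \<in> {a..<b}. lorentz (\<Gamma> t) Y = 0}"
        unfolding u using K elim lon total
        by (intro ecard_crossings_ge[OF ab cont\<Gamma> closed _ \<Gamma> strict_mono_on_longitude[OF sub incr]])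
          (auto simp: longitude_along_def intro: le_less_trans order_trans)
    qed
  qed
qed

section \<open>The integral formulas for large disks and for the whole plane\<close>

theorem theorem2p6:
  fixes \<Gamma> :: "real \<Rightarrow> real^3" and a b :: real and m :: nat and p :: "nat \<Rightarrow> real"
    and \<theta> :: "real \<Rightarrow> real" and I :: int
  assumes "closed_piecewise_smooth m p a b \<Gamma>"
    and "\<Gamma> ` {a..b} \<subseteq> de_sitter"
    and "spacelike_curve m p \<Gamma>"
    and "longitude_along \<Gamma> a b \<theta>"
    and "longitude_increasing m p \<theta>"
    and "has_index \<Gamma> a b I"
    and "I \<ge> 1"
  shows "(AE Y in hyp_area. finite (crossings \<Gamma> a b Y)) \<and>
    (\<forall>\<^sub>F R in at_top.
       set_integrable hyp_area (hyp_disk R)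
         (\<lambda>Y. real (crossing_number \<Gamma> a b Y) - 2 * real_of_int I) \<and>
       (LINT Y:hyp_disk R|hyp_area. real (crossing_number \<Gamma> a b Y) - 2 * real_of_int I)
         = - 2 * curve_length \<Gamma> a b + 4 * real_of_int I * pi) \<and>
    set_integrable hyp_area hyp_plane
      (\<lambda>Y. real (crossing_number \<Gamma> a b Y) - 2 * real_of_int I) \<and>
    curve_length \<Gamma> a b - 2 * real_of_int I * pi
      = - (1 / 2) * (LINT Y:hyp_plane|hyp_area.
            real (crossing_number \<Gamma> a b Y) - 2 * real_of_int I)"
proof -
  define n where "n = nat I"
  have nI: "real n = real_of_int I" using assms(7) by (simp add: n_def)
  define L where "L = curve_length \<Gamma> a b"
  define E where "E Y = ecard {t \<in> {a..<b}. lorentz (\<Gamma> t) Y = 0}" for Y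
  define f where "f Y = real (crossing_number \<Gamma> a b Y) - 2 * real_of_int I" for Y
  have sub: "subdivision m p a b" and cont\<Gamma>: "continuous_on {a..b} \<Gamma>"
    using assms(1) by (simp_all add: closed_piecewise_smooth_def)
  have "a \<le> b" using subdivision_mono[OF sub, of 0 m] sub by (simp add: subdivision_def)
  obtain \<theta>\<^sub>2 where "longitude_along \<Gamma> a b \<theta>\<^sub>2" "\<theta>\<^sub>2 b - \<theta>\<^sub>2 a = 2 * of_int I * pi"
    using assms(6) by (auto simp: has_index_def)
  then have total: "\<theta> b - \<theta> a = 2 * real n * pi"
    using longitude_change_unique[OF \<open>a \<le> b\<close> assms(4)] nI by simp
  have E_borel[measurable]: "E \<in> borel_measurable borel"
    unfolding E_def by (rule borel_measurable_ecard_crossings[OF cont\<Gamma>])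
  have crossings_eq: "crossings \<Gamma> a b Y = {t \<in> {a..<b}. lorentz (\<Gamma> t) Y = 0}" for Y
    using assms(2) by (auto simp: crossings_def hyp_perp_def)
  \<comment> \<open>\<open>card\<close> of an infinite set and \<open>enn2real\<close> of
    \<open>\<infinity>\<close> are both 0, so the identity holds for every \<open>Y\<close>.\<close>
  have crossing_number_eq: "real (crossing_number \<Gamma> a b Y) = enn2real (E Y)" for Y
    unfolding crossing_number_def crossings_eq E_def
    by (cases "finite {t \<in> {a..<b}. lorentz (\<Gamma> t) Y = 0}")
      (simp_all only: emeasure_count_space_finite[OF subset_UNIV] emeasure_count_space_infinite[OF subset_UNIV]
        enn2real_of_nat card.infinite enn2real_top infinity_ennreal_def of_nat_0 not_False_eq_True)
  have finite_iff: "finite (crossings \<Gamma> a b Y) \<longleftrightarrow> E Y < \<infinity>" for Y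
    unfolding crossings_eq E_def
    by (cases "finite {t \<in> {a..<b}. lorentz (\<Gamma> t) Y = 0}")
      (simp_all only: emeasure_count_space_finite[OF subset_UNIV] emeasure_count_space_infinite[OF subset_UNIV]
        infinity_ennreal_def of_nat_less_top less_irrefl not_False_eq_True)
  have f_borel[measurable]: "f \<in> borel_measurable borel"
    unfolding f_def crossing_number_eq by measurable

  \<comment> \<open>The Crofton value for the total longitude change
    \<open>2 * n * pi\<close>.\<close>
  define e where "e R = 4 * real n * pi * cosh R - 2 * L" for R
  have "\<forall>\<^sub>F R in at_top. 0 \<le> e R \<and> (\<integral>\<^sup>+Y. E Y * indicator (hyp_disk R) Y \<partial>hyp_area) = ennreal (e R)"
    using crofton_on_closed_curve[OF assms(1,3,4,5)]
    unfolding crofton_on_def total disk_crossings_def E_def[symmetric] L_def[symmetric]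
    by (auto simp: e_def elim: eventually_mono)
  moreover have "\<forall>\<^sub>F R in at_top. \<forall>Y\<in>hyp_plane - hyp_disk R. of_nat (2 * n) \<le> E Y"
    unfolding E_def by (rule eventually_ecard_crossings_ge[OF assms(1,4,5) total])
  ultimately have "\<forall>\<^sub>F R in at_top.
      (0 \<le> e R \<and> (\<integral>\<^sup>+Y. E Y * indicator (hyp_disk R) Y \<partial>hyp_area) = ennreal (e R)) \<and>
      (\<forall>Y\<in>hyp_plane - hyp_disk R. of_nat (2 * n) \<le> E Y)"
    by (rule eventually_conj)
  then obtain R0 where R0: "\<And>R. R \<ge> R0 \<Longrightarrow> 0 \<le> e R"
    "\<And>R. R \<ge> R0 \<Longrightarrow> (\<integral>\<^sup>+Y. E Y * indicator (hyp_disk R) Y \<partial>hyp_area) = ennreal (e R)"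
    "\<And>R Y. R \<ge> R0 \<Longrightarrow> Y \<in> hyp_plane \<Longrightarrow> Y \<notin> hyp_disk R \<Longrightarrow> of_nat (2 * n) \<le> E Y"
    unfolding eventually_at_top_linorder by blast
  \<comment> \<open>The maximum with 0 is taken because \<open>cosh\<close>, and with it the disk,
    grows with the radius only among nonnegative radii.\<close>
  define S where "S = max R0 0"
  have S: "S \<ge> R0" "S \<ge> 0" by (auto simp: S_def)

  have AE_plane: "AE Y in hyp_area. Y \<in> hyp_plane"
    by (subst AE_hyp_area) (auto simp: hyp_chart_in_hyp_plane)
  \<comment> \<open>The disks of radius \<open>S + k\<close> exhaust the plane, so almost-everywhere
    statements on these countably many disks pass to the plane.\<close>
  have exhaust: "\<exists>k. Y \<in> hyp_disk (S + real k)" if Y: "Y \<in> hyp_plane" for Y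
  proof -
    obtain u where u: "Y = hyp_chart u"
      using Y bij_betw_hyp_chart by (auto simp: bij_betw_def)
    obtain T where T: "\<And>R. R \<ge> T \<Longrightarrow> hyp_height u \<le> cosh R"
      using eventually_cosh_ge[of "hyp_height u"] unfolding eventually_at_top_linorder by blast
    obtain k :: nat where "T - S \<le> real k" using real_arch_simple by blast
    then show ?thesis unfolding u hyp_chart_in_hyp_disk by (intro exI[of _ k] T) simp
  qed
  have AE_disk_finite: "AE Y in hyp_area. Y \<in> hyp_disk R \<longrightarrow> E Y < \<infinity>" if "R \<ge> S" for R
  proof -
    have "(\<integral>\<^sup>+Y. E Y * indicator (hyp_disk R) Y \<partial>hyp_area) \<noteq> \<infinity>"
      using R0(2)[of R] that S by simp
    then have "AE Y in hyp_area. E Y * indicator (hyp_disk R) Y \<noteq> \<infinity>"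
      by (intro nn_integral_noteq_infinite) auto
    then show ?thesis
      by eventually_elim (auto simp: less_top)
  qed
  have "AE Y in hyp_area. \<forall>k. Y \<in> hyp_disk (S + real k) \<longrightarrow> E Y < \<infinity>"
    unfolding AE_all_countable by (intro allI AE_disk_finite) simp
  with AE_plane have AE_finite: "AE Y in hyp_area. E Y < \<infinity>"
    by eventually_elim (use exhaust in blast)

  have disk_mono: "hyp_disk R \<subseteq> hyp_disk R'" if "0 \<le> R" "R \<le> R'" for R R'
    using cosh_real_nonneg_le_iff[of R R'] that by (auto simp: hyp_disk_def)
  \<comment> \<open>On the annulus the count is at least \<open>2 * n\<close> and has the same
    finite integral as this constant: both integrals equal \<open>e R - e S\<close>, in which the
    length cancels. Hence the two agree almost everywhere.\<close>
  have AE_annulus: "AE Y in hyp_area. Y \<in> hyp_disk R - hyp_disk S \<longrightarrow> E Y = of_nat (2 * n)" if R: "R \<ge> S" for R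
  proof -
    let ?D = "hyp_disk R - hyp_disk S" and ?c = "of_nat (2 * n) :: ennreal"
    have sub: "hyp_disk S \<subseteq> hyp_disk R" using disk_mono S(2) R .
    have cosh: "1 \<le> cosh S" "cosh S \<le> cosh R"
      using cosh_real_nonneg_le_iff[of S R] S(2) R by (auto simp: cosh_real_ge_1)
    have split: "(\<integral>\<^sup>+Y. g Y * indicator (hyp_disk R) Y \<partial>hyp_area) =
        (\<integral>\<^sup>+Y. g Y * indicator ?D Y \<partial>hyp_area) + (\<integral>\<^sup>+Y. g Y * indicator (hyp_disk S) Y \<partial>hyp_area)"
      if [measurable]: "g \<in> borel_measurable borel" for g :: "real^3 \<Rightarrow> ennreal"
    proof -
      have "(\<integral>\<^sup>+Y. g Y * indicator (hyp_disk R) Y \<partial>hyp_area) =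
          (\<integral>\<^sup>+Y. g Y * indicator ?D Y + g Y * indicator (hyp_disk S) Y \<partial>hyp_area)"
        using sub by (intro nn_integral_cong) (auto simp: indicator_def)
      also have "\<dots> = (\<integral>\<^sup>+Y. g Y * indicator ?D Y \<partial>hyp_area) + (\<integral>\<^sup>+Y. g Y * indicator (hyp_disk S) Y \<partial>hyp_area)"
        by (rule nn_integral_add) measurable
      finally show ?thesis .
    qed
    have disk_c: "(\<integral>\<^sup>+Y. ?c * indicator (hyp_disk r) Y \<partial>hyp_area) = ennreal (4 * real n * pi * (cosh r - 1))" for r
    proof -
      have "(\<integral>\<^sup>+Y. ?c * indicator (hyp_disk r) Y \<partial>hyp_area) = ennreal (real (2 * n)) * ennreal (2 * pi * (cosh r - 1))"
        by (simp only: nn_integral_cmult_indicator sets_hyp_area hyp_disk_borel emeasure_hyp_disk ennreal_of_nat_eq_real_of_nat)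
      also have "\<dots> = ennreal (real (2 * n) * (2 * pi * (cosh r - 1)))"
        using cosh_real_ge_1[of r] by (intro ennreal_mult[symmetric]) auto
      finally show ?thesis by (simp add: algebra_simps)
    qed
    have ED: "(\<integral>\<^sup>+Y. E Y * indicator ?D Y \<partial>hyp_area) = ennreal (e R - e S)"
    proof -
      have "(\<integral>\<^sup>+Y. E Y * indicator ?D Y \<partial>hyp_area) = ennreal (e R) - ennreal (e S)"
        using split[OF E_borel] R0(2)[of R] R0(2)[of S] S R by simp
      then show ?thesis using R0(1)[of S] S by (simp add: ennreal_minus)
    qed
    have cD: "(\<integral>\<^sup>+Y. ?c * indicator ?D Y \<partial>hyp_area) = ennreal (e R - e S)"
    proof -
      have "(\<integral>\<^sup>+Y. ?c * indicator ?D Y \<partial>hyp_area) =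
          ennreal (4 * real n * pi * (cosh R - 1)) - ennreal (4 * real n * pi * (cosh S - 1))"
        using split[of "\<lambda>_. ?c"] unfolding disk_c by simp
      also have "\<dots> = ennreal (4 * real n * pi * (cosh R - 1) - 4 * real n * pi * (cosh S - 1))"
        using cosh by (intro ennreal_minus) simp
      also have "4 * real n * pi * (cosh R - 1) - 4 * real n * pi * (cosh S - 1) = e R - e S"
        by (simp add: e_def algebra_simps)
      finally show ?thesis .
    qed
    have ge: "AE Y in hyp_area. ?c * indicator ?D Y \<le> E Y * indicator ?D Y"
      using S R0(3)[of S] by (auto simp: indicator_def hyp_disk_def)
    have "(\<integral>\<^sup>+Y. E Y * indicator ?D Y - ?c * indicator ?D Y \<partial>hyp_area) =
        (\<integral>\<^sup>+Y. E Y * indicator ?D Y \<partial>hyp_area) - (\<integral>\<^sup>+Y. ?c * indicator ?D Y \<partial>hyp_area)"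
    proof (rule nn_integral_diff[OF _ _ _ ge])
      show "(\<integral>\<^sup>+Y. ?c * indicator ?D Y \<partial>hyp_area) \<noteq> \<infinity>" unfolding cD by simp
    qed measurable
    also have "\<dots> = 0" unfolding ED cD by (simp add: diff_eq_0_iff_ennreal)
    finally have "AE Y in hyp_area. E Y * indicator ?D Y - ?c * indicator ?D Y = 0"
      by (subst (asm) nn_integral_0_iff_AE) auto
    \<comment> \<open>Subtraction in \<open>ennreal\<close> is truncated, so a vanishing difference
      only yields \<open>E Y \<le> 2 * n\<close> on the annulus; \<open>ge\<close> supplies the
      other inequality.\<close>
    with ge AE_finite show ?thesis
    proof eventually_elim
      case (elim Y)
      then show ?case by (auto simp: indicator_def diff_eq_0_iff_ennreal intro: antisym)
    qed
  qed
  have "AE Y in hyp_area. \<forall>k. Y \<in> hyp_disk (S + real k) - hyp_disk S \<longrightarrow> E Y = of_nat (2 * n)"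
    unfolding AE_all_countable by (intro allI AE_annulus) simp
  with AE_plane have AE_outside: "AE Y in hyp_area. Y \<notin> hyp_disk S \<longrightarrow> E Y = of_nat (2 * n)"
    by eventually_elim (use exhaust in blast)

  \<comment> \<open>The count and the constant \<open>2 * n\<close> are both integrable over the
    disk. In the difference of their integrals the terms with \<open>cosh R\<close> cancel, so the
    value is independent of \<open>R\<close>.\<close>
  have disk: "has_bochner_integral hyp_area (\<lambda>Y. indicator (hyp_disk R) Y *\<^sub>R f Y) (4 * real n * pi - 2 * L)"
    if R: "R \<ge> S" for R
  proof -
    have "has_bochner_integral hyp_area (\<lambda>Y. indicator (hyp_disk R) Y * enn2real (E Y)) (e R)"
    proof (rule has_bochner_integral_nn_integral)
      show "0 \<le> e R" using R0(1) R S by simp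
      have "(\<integral>\<^sup>+Y. ennreal (indicator (hyp_disk R) Y * enn2real (E Y)) \<partial>hyp_area) =
          (\<integral>\<^sup>+Y. E Y * indicator (hyp_disk R) Y \<partial>hyp_area)"
        using AE_finite by (intro nn_integral_cong_AE) (auto simp: indicator_def)
      then show "(\<integral>\<^sup>+Y. ennreal (indicator (hyp_disk R) Y * enn2real (E Y)) \<partial>hyp_area) = ennreal (e R)"
        using R0(2)[of R] R S by simp
    qed auto
    moreover have "has_bochner_integral hyp_area (\<lambda>Y. indicator (hyp_disk R) Y * (2 * real n)) (2 * pi * (cosh R - 1) * (2 * real n))"
    proof (intro has_bochner_integral_mult_left)
      have "measure hyp_area (hyp_disk R) = 2 * pi * (cosh R - 1)"
        using cosh_real_ge_1[of R] by (simp add: measure_def emeasure_hyp_disk)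
      then show "has_bochner_integral hyp_area (indicator (hyp_disk R)) (2 * pi * (cosh R - 1))"
        using has_bochner_integral_real_indicator[of "hyp_disk R" hyp_area] by (simp add: emeasure_hyp_disk)
    qed
    ultimately have "has_bochner_integral hyp_area
        (\<lambda>Y. indicator (hyp_disk R) Y * enn2real (E Y) - indicator (hyp_disk R) Y * (2 * real n))
        (e R - 2 * pi * (cosh R - 1) * (2 * real n))"
      by (rule has_bochner_integral_diff)
    moreover have "e R - 2 * pi * (cosh R - 1) * (2 * real n) = 4 * real n * pi - 2 * L"
      by (simp add: e_def algebra_simps)
    ultimately show ?thesis
      by (simp add: f_def crossing_number_eq nI[symmetric] right_diff_distrib)
  qed
  \<comment> \<open>Outside \<open>hyp_disk S\<close> the integrand vanishes almost everywhere, so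
    it is integrable over the plane with the same integral as over that disk.\<close>
  have plane: "has_bochner_integral hyp_area (\<lambda>Y. indicator hyp_plane Y *\<^sub>R f Y) (4 * real n * pi - 2 * L)"
  proof -
    have "AE Y in hyp_area. indicator hyp_plane Y *\<^sub>R f Y = indicator (hyp_disk S) Y *\<^sub>R f Y"
      using AE_outside AE_plane
    proof eventually_elim
      case (elim Y)
      then show ?case
        by (cases "Y \<in> hyp_disk S") (simp_all add: f_def crossing_number_eq nI[symmetric] del: of_nat_mult)
    qed
    then show ?thesis
      using disk[of S] by (subst has_bochner_integral_cong_AE) auto
  qed
  have "AE Y in hyp_area. finite (crossings \<Gamma> a b Y)"
    using AE_finite by (simp add: finite_iff)
  moreover have "\<forall>\<^sub>F R in at_top. set_integrable hyp_area (hyp_disk R) f \<and>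
      (LINT Y:hyp_disk R|hyp_area. f Y) = - 2 * curve_length \<Gamma> a b + 4 * real_of_int I * pi"
    using eventually_ge_at_top[of S]
    by eventually_elim (use disk in \<open>auto simp: has_bochner_integral_iff set_integrable_def
        set_lebesgue_integral_def L_def nI\<close>)
  moreover have "set_integrable hyp_area hyp_plane f"
    using plane by (auto simp: has_bochner_integral_iff set_integrable_def)
  moreover have "curve_length \<Gamma> a b - 2 * real_of_int I * pi =
      - (1 / 2) * (LINT Y:hyp_plane|hyp_area. f Y)"
  proof -
    have "(LINT Y:hyp_plane|hyp_area. f Y) = 4 * real_of_int I * pi - 2 * curve_length \<Gamma> a b"
      using plane by (simp add: has_bochner_integral_iff set_lebesgue_integral_def L_def nI)
    then show ?thesis by (simp only:) (simp add: field_simps)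
  qed
  ultimately show ?thesis
    unfolding f_def by blast
qed

end
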